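(* Consider the $T$-round committed-pricing game with $n$ buyers and network weights $g_{ij}\ge 0$ (see context; rounds are indexed $T,T-1,\dots,1$ in order of time). (a) The seller's optimal price sequence is non-decreasing over time, in the following sense: for any optimal price sequence there is a corresponding price sequence that is non-decreasing over time ($p_T\le p_{T-1}\le\dots\le p_1$) for which the equilibrium path (the purchase decisions of the buyers) remains the same. (b) Given a price sequence that is non-decreasing over time, the purchase decision of each buyer $i\in\{1,\dots,n\}$ in any equilibrium is a threshold decision: for each $i$ there exists a sequence of (time and history dependent) thresholds $v^{(i)}_T,\dots,v^{(i)}_1$, $v^{(i)}_t=v^{(i)}_t(H^t)$, such that $v^{(i)}_t\ge v^{(i)}_{t-1}$ for $2\le t\le T$, and buyer $i$ (if she has not yet purchased) purchases at round $t$ if and only if $v^{(i)}\ge v^{(i)}_t$.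
   Context: Game. A monopolist with unlimited supply and zero marginal cost sells to $n$ buyers over $T$ rounds. Rounds are indexed in decreasing order: round $T$ is the first in time and round $1$ is the last. The seller announces and commits to prices $\mathbf{p}=(p_T,\dots,p_1)$. Each buyer buys at most one unit, at one of the rounds or never. The valuations $v^{(1)},\dots,v^{(n)}$ are drawn independently from a known continuous distribution $F_v$ on $[0,1]$ and are private. $h^t$ is the set of buyers who buy at round $t$, and the publicly observed history at round $t$ is $H^t=\{h^{T+1},h^T,\dots,h^{t+1}\}$, with $h^{T+1}=\emptyset$. Weights $g_{ij}\ge0$ are given. Buyer $i$ buying at round $t$ gets utility $$u_i(\mathbf{v},\mathbf{p},H^t)=v^{(i)}-p_t+\sum_{j\neq i}g_{ij}\mathbf{1}\{j\text{ has bought at some round }s>t\};$$ a buyer who never buys gets $0$. A (pure) strategy for buyer $i$ is a sequence of maps $b_i^t$ ($t=1,\dots,T$) from her valuation, the history $H^t$ and the price sequence to $\{0,1\}$ (buy or not). A perfect Bayesian equilibrium ("equilibrium") is a collection of strategies in which each buyer maximizes her expected utility given her beliefs (updated by Bayes' rule) and the other buyers' strategies; in particular a buyer who has not yet bought buys at round $t$ if and only if $u_i(\mathbf{v},\mathbf{p},H^t)$ is at least the maximal expected utility, conditional on $H^t$, from the remaining alternatives (postponing to future rounds $s<t$). The expected revenue for $\mathbf{p}$ is $\sum_{t=1}^T\sum_{i=1}^n p_t\,\mathbb{P}[i\text{ buys at round }t]$; a price sequence maximizing it is called optimal.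
   Formalization: In (a) the equilibrium path is the same up to an order-preserving shift of rounds that moves only empty rounds (same buyers, same prices paid); in (b) the thresholds describe a buyer who has not yet purchased in accordance with her own strategy, since both claims fail if read literally. *)

theory Defs
  imports "HOL-Probability.Probability"
begin

text \<open>
  Rounds are numbered in decreasing order of time: \<open>T\<close> is the first round and \<open>1\<close> the last one.
  A history lists the sets of buyers of the past rounds in chronological order, so that the history
  before round \<open>t\<close> is \<open>[h T, \<dots>, h (t + 1)]\<close>, of length \<open>T - t\<close>, and \<open>[]\<close> is the history before
  round \<open>T\<close>. A history of length \<open>T\<close> (``before round 0'') is a complete play.
  The buyers are the elements of a finite type \<open>'b\<close>.
\<close>

type_synonym 'b history = "'b set list"

text \<open>
  \<open>\<sigma> i t x H\<close>: buyer \<open>i\<close> with valuation \<open>x\<close> buys at round \<open>t\<close> after history \<open>H\<close>, provided she has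
  not bought in \<open>H\<close>. The dependence on the announced prices is left to the context:
  \<open>(nat \<Rightarrow> real) \<Rightarrow> 'b profile\<close> is the type of price-dependent strategy profiles.
\<close>

type_synonym 'b strategy = "nat \<Rightarrow> real \<Rightarrow> 'b history \<Rightarrow> bool"
type_synonym 'b profile = "'b \<Rightarrow> 'b strategy"

definition bought :: "'b history \<Rightarrow> 'b set" where
  "bought H = \<Union> (set H)"

definition histories :: "nat \<Rightarrow> nat \<Rightarrow> 'b history set" where
  "histories T t =
     {H. length H = T - t \<and> (\<forall>k < length H. \<forall>l < k. H ! k \<inter> H ! l = {})}"

definition purchasers :: "'b profile \<Rightarrow> nat \<Rightarrow> ('b \<Rightarrow> real) \<Rightarrow> 'b history \<Rightarrow> 'b set" where
  "purchasers \<sigma> t v H = {j. j \<notin> bought H \<and> \<sigma> j t (v j) H}"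

text \<open>The complete play that results when rounds \<open>t, \<dots>, 1\<close> are played from history \<open>H\<close>.\<close>

primrec play :: "'b profile \<Rightarrow> nat \<Rightarrow> ('b \<Rightarrow> real) \<Rightarrow> 'b history \<Rightarrow> 'b history" where
  "play \<sigma> 0 v H = H"
| "play \<sigma> (Suc t) v H = play \<sigma> t v (H @ [purchasers \<sigma> (Suc t) v H])"

text \<open>The set \<open>h t\<close> of those who buy at round \<open>t\<close> on the path of play, if the valuations are \<open>v\<close>.\<close>

definition buyers_at :: "nat \<Rightarrow> 'b profile \<Rightarrow> ('b \<Rightarrow> real) \<Rightarrow> nat \<Rightarrow> 'b set" where
  "buyers_at T \<sigma> v t = play \<sigma> T v [] ! (T - t)"

definition utility ::
  "('b::finite \<Rightarrow> 'b \<Rightarrow> real) \<Rightarrow> (nat \<Rightarrow> real) \<Rightarrow> 'b \<Rightarrow> real \<Rightarrow> nat \<Rightarrow> 'b history \<Rightarrow> real" where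
  "utility g p i x t H = x - p t + (\<Sum>j \<in> UNIV - {i}. g i j * of_bool (j \<in> bought H))"

text \<open>
  Realised utility in a complete play. Nobody buys twice, so that at most one summand is nonzero;
  a buyer who never buys gets \<open>0\<close>.
\<close>

definition payoff ::
  "('b::finite \<Rightarrow> 'b \<Rightarrow> real) \<Rightarrow> (nat \<Rightarrow> real) \<Rightarrow> 'b \<Rightarrow> real \<Rightarrow> 'b history \<Rightarrow> real" where
  "payoff g p i x h =
     (\<Sum>t = 1..length h.
        if i \<in> h ! (length h - t) then utility g p i x t (take (length h - t) h) else 0)"

text \<open>
  Expected utility of buyer \<open>i\<close> with valuation \<open>x\<close> at round \<open>t\<close> after history \<open>H\<close>, when she uses the
  strategy \<open>\<delta>\<close> from now on, the others use \<open>\<sigma>\<close>, and \<open>M\<close> is her belief about the valuations of the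
  others.
\<close>

definition expected_payoff ::
  "('b::finite \<Rightarrow> 'b \<Rightarrow> real) \<Rightarrow> (nat \<Rightarrow> real) \<Rightarrow> 'b profile \<Rightarrow> ('b \<Rightarrow> real) measure \<Rightarrow>
   'b \<Rightarrow> real \<Rightarrow> nat \<Rightarrow> 'b history \<Rightarrow> 'b strategy \<Rightarrow> real" where
  "expected_payoff g p \<sigma> M i x t H \<delta> =
     (\<integral>w. payoff g p i x (play (\<sigma>(i := \<delta>)) t (w(i := x)) H) \<partial>M)"

text \<open>Maximal expected utility from not buying at round \<open>t\<close>.\<close>

definition waiting_value ::
  "('b::finite \<Rightarrow> 'b \<Rightarrow> real) \<Rightarrow> (nat \<Rightarrow> real) \<Rightarrow> 'b profile \<Rightarrow> ('b \<Rightarrow> real) measure \<Rightarrow>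
   'b \<Rightarrow> real \<Rightarrow> nat \<Rightarrow> 'b history \<Rightarrow> real" where
  "waiting_value g p \<sigma> M i x t H =
     (SUP \<delta> \<in> {\<delta>. \<not> \<delta> t x H}. expected_payoff g p \<sigma> M i x t H \<delta>)"

text \<open>
  \<open>\<mu> i H\<close> is the belief of buyer \<open>i\<close> after history \<open>H\<close> about the valuations of the other buyers. It
  starts from the prior and is updated by Bayes' rule after every round in which the observed
  behaviour of the others has positive probability under the current belief; otherwise the new belief
  is an arbitrary distribution on the possible valuations. The valuations being independent, a
  belief does not depend on the buyer's own valuation. Bayes' rule is not
  imposed on a buyer who has already bought, since she makes no further decision. The set
  \<open>purchasers \<sigma> t w H - {i}\<close> depends only on the coordinates of \<open>w\<close> other than \<open>i\<close>.
\<close>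

definition bayesian_beliefs ::
  "nat \<Rightarrow> real measure \<Rightarrow> 'b::finite profile \<Rightarrow> ('b \<Rightarrow> 'b history \<Rightarrow> ('b \<Rightarrow> real) measure) \<Rightarrow> bool"
where
  "bayesian_beliefs T F \<sigma> \<mu> \<longleftrightarrow>
     (\<forall>i. \<mu> i [] = PiM (UNIV - {i}) (\<lambda>_. F)) \<and>
     (\<forall>i. \<forall>t \<le> T. \<forall>H \<in> histories T t.
        prob_space (\<mu> i H) \<and> sets (\<mu> i H) = sets (PiM (UNIV - {i}) (\<lambda>_. F)) \<and>
        (AE w in \<mu> i H. \<forall>j \<in> UNIV - {i}. w j \<in> {0..1})) \<and>
     (\<forall>i. \<forall>t \<in> {1..T}. \<forall>H \<in> histories T t. \<forall>h.
        H @ [h] \<in> histories T (t - 1) \<and> i \<notin> bought (H @ [h]) \<longrightarrow>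
        (let A = {w \<in> space (\<mu> i H). purchasers \<sigma> t w H - {i} = h}
         in measure (\<mu> i H) A > 0 \<longrightarrow> \<mu> i (H @ [h]) = uniform_measure (\<mu> i H) A))"

text \<open>
  Perfect Bayesian equilibrium of the game that follows the announcement of the prices \<open>p\<close>. After
  every history, each buyer who has not yet bought maximizes her expected utility; the last clause
  fixes in addition that she buys if she is indifferent between buying now and postponing.
\<close>

definition equilibrium ::
  "nat \<Rightarrow> ('b::finite \<Rightarrow> 'b \<Rightarrow> real) \<Rightarrow> real measure \<Rightarrow> (nat \<Rightarrow> real) \<Rightarrow> 'b profile \<Rightarrow> bool" where
  "equilibrium T g F p \<sigma> \<longleftrightarrow>
     (\<forall>i t H. {x. \<sigma> i t x H} \<in> sets borel) \<and>
     (\<exists>\<mu>. bayesian_beliefs T F \<sigma> \<mu> \<and>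
        (\<forall>i. \<forall>t \<in> {1..T}. \<forall>H \<in> histories T t. \<forall>x \<in> {0..1}. i \<notin> bought H \<longrightarrow>
           (\<forall>\<delta>. expected_payoff g p \<sigma> (\<mu> i H) i x t H \<delta>
                 \<le> expected_payoff g p \<sigma> (\<mu> i H) i x t H (\<sigma> i)) \<and>
           (\<sigma> i t x H \<longleftrightarrow> utility g p i x t H \<ge> waiting_value g p \<sigma> (\<mu> i H) i x t H)))"

definition revenue ::
  "nat \<Rightarrow> real measure \<Rightarrow> (nat \<Rightarrow> real) \<Rightarrow> 'b::finite profile \<Rightarrow> real" where
  "revenue T F p \<sigma> =
     (\<Sum>t = 1..T. \<Sum>i \<in> UNIV.
        p t * measure (PiM UNIV (\<lambda>_. F)) {v \<in> space (PiM UNIV (\<lambda>_. F)). i \<in> buyers_at T \<sigma> v t})"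

text \<open>
  A price sequence may have several equilibria, or none (because of the tie-breaking rule), so the
  revenue of a price sequence is relative to a price-dependent strategy profile \<open>b\<close> that selects an
  equilibrium whenever there is one. Only price sequences with an equilibrium have a revenue.
\<close>

definition equilibrium_selection ::
  "nat \<Rightarrow> ('b::finite \<Rightarrow> 'b \<Rightarrow> real) \<Rightarrow> real measure \<Rightarrow> ((nat \<Rightarrow> real) \<Rightarrow> 'b profile) \<Rightarrow> bool" where
  "equilibrium_selection T g F b \<longleftrightarrow>
     (\<forall>q. (\<exists>\<sigma>. equilibrium T g F q \<sigma>) \<longrightarrow> equilibrium T g F q (b q))"

definition optimal_prices ::
  "nat \<Rightarrow> ('b::finite \<Rightarrow> 'b \<Rightarrow> real) \<Rightarrow> real measure \<Rightarrow> ((nat \<Rightarrow> real) \<Rightarrow> 'b profile) \<Rightarrow>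
   (nat \<Rightarrow> real) \<Rightarrow> bool" where
  "optimal_prices T g F b p \<longleftrightarrow>
     equilibrium T g F p (b p) \<and>
     (\<forall>q. equilibrium T g F q (b q) \<longrightarrow> revenue T F q (b q) \<le> revenue T F p (b p))"

text \<open>Rounds are numbered backwards, so prices that do not decrease over time are antitone in the index.\<close>

definition nondecreasing_over_time :: "nat \<Rightarrow> (nat \<Rightarrow> real) \<Rightarrow> bool" where
  "nondecreasing_over_time T p \<longleftrightarrow> antimono_on {1..T} p"

text \<open>
  The two paths of play agree for all valuations up to the position of rounds in which nobody buys:
  the purchases at a round \<open>t\<close> in \<open>R\<close> under \<open>\<sigma>\<close> are those at round \<open>\<rho> t\<close> under \<open>\<sigma>'\<close>, and there are no
  other purchases. Agreement round by round cannot be demanded: a single buyer who faces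
  \<open>p 2 = 1\<close>, \<open>p 1 = 1 / 2\<close> and has a valuation strictly between \<open>1 / 2\<close> and \<open>1\<close> buys at round \<open>1\<close>,
  which no prices with \<open>p 2 \<le> p 1\<close> achieve.
\<close>

definition same_path_retimed ::
  "nat \<Rightarrow> nat set \<Rightarrow> (nat \<Rightarrow> nat) \<Rightarrow> 'b profile \<Rightarrow> 'b profile \<Rightarrow> bool" where
  "same_path_retimed T R \<rho> \<sigma> \<sigma>' \<longleftrightarrow>
     (\<forall>v. (\<forall>i. v i \<in> {0..1}) \<longrightarrow>
        (\<forall>t \<in> R. buyers_at T \<sigma> v t = buyers_at T \<sigma>' v (\<rho> t)) \<and>
        (\<forall>t \<in> {1..T} - R. buyers_at T \<sigma> v t = {}) \<and>
        (\<forall>t \<in> {1..T} - \<rho> ` R. buyers_at T \<sigma>' v t = {}))"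

text \<open>
  \<open>p\<close> and \<open>p'\<close> have the same equilibrium paths, with the same prices paid, for one re-timing of
  rounds that preserves their order and serves all equilibria.
\<close>

definition same_equilibrium_paths ::
  "nat \<Rightarrow> ('b::finite \<Rightarrow> 'b \<Rightarrow> real) \<Rightarrow> real measure \<Rightarrow> (nat \<Rightarrow> real) \<Rightarrow> (nat \<Rightarrow> real) \<Rightarrow> bool" where
  "same_equilibrium_paths T g F p p' \<longleftrightarrow>
     (\<exists>R \<rho>. R \<subseteq> {1..T} \<and> \<rho> ` R \<subseteq> {1..T} \<and> strict_mono_on R \<rho> \<and> (\<forall>t \<in> R. p' (\<rho> t) = p t) \<and>
        (\<forall>\<sigma>. equilibrium T g F p \<sigma> \<longrightarrow>
           (\<exists>\<sigma>'. equilibrium T g F p' \<sigma>' \<and> same_path_retimed T R \<rho> \<sigma> \<sigma>')) \<and>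
        (\<forall>\<sigma>'. equilibrium T g F p' \<sigma>' \<longrightarrow>
           (\<exists>\<sigma>. equilibrium T g F p \<sigma> \<and> same_path_retimed T R \<rho> \<sigma> \<sigma>')))"

text \<open>
  Buyer \<open>i\<close> with valuation \<open>x\<close> has not bought in \<open>H\<close>, in accordance with her strategy; the
  behaviour of the other buyers in \<open>H\<close> is arbitrary.
\<close>

definition not_yet_purchased ::
  "nat \<Rightarrow> 'b profile \<Rightarrow> 'b \<Rightarrow> real \<Rightarrow> 'b history \<Rightarrow> bool" where
  "not_yet_purchased T \<sigma> i x H \<longleftrightarrow>
     i \<notin> bought H \<and> (\<forall>k < length H. \<not> \<sigma> i (T - k) x (take k H))"

text \<open>
  The thresholds describe the decisions in the course of the play. They cannot be non-increasing
  over time if they are also to describe what a buyer would do after having departed from her own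
  strategy: facing \<open>p 2 = 0\<close>, \<open>p 1 = 1 / 2\<close>, a single buyer buys at round \<open>2\<close> whatever her valuation,
  but had she not done so she would buy at round \<open>1\<close> only with a valuation of at least \<open>1 / 2\<close>.
\<close>

definition threshold_decision :: "nat \<Rightarrow> 'b profile \<Rightarrow> 'b \<Rightarrow> bool" where
  "threshold_decision T \<sigma> i \<longleftrightarrow>
     (\<exists>\<theta> :: nat \<Rightarrow> 'b history \<Rightarrow> real.
        (\<forall>t \<in> {2..T}. \<forall>H \<in> histories T t. \<forall>h.
           H @ [h] \<in> histories T (t - 1) \<longrightarrow> \<theta> t H \<ge> \<theta> (t - 1) (H @ [h])) \<and>
        (\<forall>t \<in> {1..T}. \<forall>H \<in> histories T t. \<forall>x \<in> {0..1}.
           not_yet_purchased T \<sigma> i x H \<longrightarrow> (\<sigma> i t x H \<longleftrightarrow> x \<ge> \<theta> t H)))"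

end

theory Submission
  imports Defs
begin

text \<open>
  A round with a strictly cheaper later round is idle: whoever would buy there does better by waiting
  for the next round that is not undercut, because the externality can only have grown meanwhile. The
  prices at the remaining, live rounds do not decrease over time. Move them to the front and fill the
  tail with prohibitive prices. An equilibrium of either game is copied to the other along
  histories without purchases at idle rounds. After any other history, which has probability zero
  whatever the belief, one continues with an equilibrium known beforehand: nobody buys any more in the
  prohibitive tail, and the given equilibrium of the optimal prices does the job in the original game.

  For the thresholds: the waiting value is 1-Lipschitz in the valuation \<open>x\<close>, while the utility of buying
  now grows with slope 1, so the set of valuations that buy is closed and upward closed in \<open>[0, 1]\<close>.
\<close>

section \<open>Continuation payoffs\<close>

text \<open>The two games pass their idle rounds at different times, so their histories cannot be
  compared round by round. The comparison is asynchronous: an idle round of either game is passed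
  alone with an empty set of buyers, corresponding live rounds are passed together. This relation is
  symmetric in the two games, so one transfer lemma serves both directions.

  Two things must survive the transfer. A deviation may buy at an idle round, where there is nothing
  to copy; its idle purchases are put off, which costs nothing, and only then is it carried over. A
  belief must not depend on how many idle rounds have gone by: equilibrium play is silent there for
  every valuation in [0, 1], so the silence has probability one and Bayes' rule changes nothing.

  Equilibrium is restated as a condition at each single history that looks only at what happens from
  there on. This makes it possible to glue the copied play to a fixed profile on the subgames where
  somebody has bought at an idle round; these have no counterpart in the other game.\<close>

primrec continuation ::
  "('b::finite \<Rightarrow> 'b \<Rightarrow> real) \<Rightarrow> (nat \<Rightarrow> real) \<Rightarrow> 'b profile \<Rightarrow> 'b strategy \<Rightarrow> 'b \<Rightarrow> real \<Rightarrow> nat \<Rightarrow>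
   ('b \<Rightarrow> real) \<Rightarrow> 'b history \<Rightarrow> real" where
  "continuation g p \<sigma> \<delta> i x 0 w H = 0"
| "continuation g p \<sigma> \<delta> i x (Suc t) w H =
     (if \<delta> (Suc t) x H then utility g p i x (Suc t) H
      else continuation g p \<sigma> \<delta> i x t w (H @ [purchasers \<sigma> (Suc t) w H - {i}]))"

lemma bought_append [simp]: "bought (G @ H) = bought G \<union> bought H"
  and bought_Cons [simp]: "bought (h # H) = h \<union> bought H"
  and bought_Nil [simp]: "bought [] = {}"
  by (auto simp: bought_def)

lemma play_extends:
  "\<exists>G. play \<sigma> t v H = H @ G \<and> length G = t \<and> bought G \<inter> bought H = {}"
proof (induction t arbitrary: H)
  case (Suc t)
  let ?P = "purchasers \<sigma> (Suc t) v H"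
  obtain G where "play \<sigma> t v (H @ [?P]) = (H @ [?P]) @ G" "length G = t"
    "bought G \<inter> bought (H @ [?P]) = {}"
    using Suc by blast
  then show ?case
    by (intro exI[of _ "?P # G"]) (auto simp: purchasers_def)
qed auto

lemma payoff_not_bought: "i \<notin> bought H \<Longrightarrow> payoff g p i x H = 0"
  unfolding payoff_def bought_def by (intro sum.neutral) auto

text \<open>After her own purchase nothing more contributes to her payoff, since
  \<open>play_extends\<close> excludes a second one, so the recursion may stop there. Before it she
  is absent from every set of buyers, which is why removing \<open>i\<close> erases her own
  component of the profile and of \<open>w\<close>.\<close>

lemma payoff_play_eq_continuation:
  assumes "i \<notin> bought H"
  shows "payoff g p i x (play (\<sigma>(i := \<delta>)) t (w(i := x)) H) = continuation g p \<sigma> \<delta> i x t w H"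
  using assms
proof (induction t arbitrary: H)
  case 0
  then show ?case by (simp add: payoff_not_bought)
next
  case (Suc t)
  let ?P = "purchasers (\<sigma>(i := \<delta>)) (Suc t) (w(i := x)) H"
  show ?case
  proof (cases "\<delta> (Suc t) x H")
    case True
    have iP: "i \<in> ?P" using True Suc.prems by (simp add: purchasers_def)
    obtain G where G: "play (\<sigma>(i := \<delta>)) t (w(i := x)) (H @ [?P]) = (H @ [?P]) @ G" "length G = t"
      "bought G \<inter> bought (H @ [?P]) = {}"
      using play_extends[of "\<sigma>(i := \<delta>)" t "w(i := x)" "H @ [?P]"] by (elim exE conjE)
    let ?h = "(H @ [?P]) @ G"
    have iG: "i \<notin> bought G" using G(3) iP by auto
    have idx: "i \<in> ?h ! k \<longleftrightarrow> k = length H" if "k < length ?h" for k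
    proof -
      have "i \<notin> H ! k" if "k < length H" using Suc.prems that by (auto simp: bought_def)
      moreover have "i \<notin> G ! l" if "l < length G" for l using iG that by (auto simp: bought_def)
      ultimately show ?thesis using that iP
        by (cases "k - length H") (auto simp: nth_append)
    qed
    have "payoff g p i x ?h = (\<Sum>s = 1..length ?h. if s = Suc t then utility g p i x (Suc t) H else 0)"
      unfolding payoff_def
    proof (rule sum.cong[OF refl])
      fix s assume s: "s \<in> {1..length ?h}"
      then have "i \<in> ?h ! (length ?h - s) \<longleftrightarrow> length ?h - s = length H"
        by (intro idx) auto
      also have "\<dots> \<longleftrightarrow> s = Suc t" using s G(2) by auto
      finally show "(if i \<in> ?h ! (length ?h - s) then utility g p i x s (take (length ?h - s) ?h) else 0)
        = (if s = Suc t then utility g p i x (Suc t) H else 0)"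
        using G(2) by auto
    qed
    also have "\<dots> = utility g p i x (Suc t) H" using G(2) by (simp add: Suc_le_eq)
    finally show ?thesis using True by (simp only: play.simps G(1) continuation.simps if_True)
  next
    case False
    have "?P = purchasers \<sigma> (Suc t) w H - {i}"
      using False by (auto simp: purchasers_def split: if_splits)
    moreover from this Suc.prems have "i \<notin> bought (H @ [?P])" by auto
    ultimately show ?thesis
      using Suc.IH[of "H @ [?P]"] False by (simp only: play.simps continuation.simps if_False not_False_eq_True)
  qed
qed

corollary expected_payoff_eq_continuation:
  "i \<notin> bought H \<Longrightarrow>
     expected_payoff g p \<sigma> M i x t H \<delta> = (\<integral>w. continuation g p \<sigma> \<delta> i x t w H \<partial>M)"
  by (simp add: expected_payoff_def payoff_play_eq_continuation)

lemma utility_bounded: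
  "\<bar>utility g p i x t H\<bar> \<le> \<bar>x\<bar> + \<bar>p t\<bar> + (\<Sum>j\<in>UNIV. \<bar>g i j\<bar>)"
proof -
  have "\<bar>\<Sum>j\<in>UNIV - {i}. g i j * of_bool (j \<in> bought H)\<bar> \<le> (\<Sum>j\<in>UNIV - {i}. \<bar>g i j\<bar>)"
    by (rule order.trans[OF sum_abs]) (intro sum_mono, auto)
  also have "\<dots> \<le> (\<Sum>j\<in>UNIV. \<bar>g i j\<bar>)" by (intro sum_mono2) auto
  finally show ?thesis unfolding utility_def by linarith
qed

lemma continuation_bounded:
  "\<bar>continuation g p \<sigma> \<delta> i x t w H\<bar> \<le> \<bar>x\<bar> + (\<Sum>s = 1..t. \<bar>p s\<bar>) + (\<Sum>j\<in>UNIV. \<bar>g i j\<bar>)"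
proof (induction t arbitrary: H)
  case 0
  then show ?case by (simp add: sum_nonneg)
next
  case (Suc t)
  have "0 \<le> (\<Sum>s = 1..t. \<bar>p s\<bar>)" by (simp add: sum_nonneg)
  moreover have S: "(\<Sum>s = 1..Suc t. \<bar>p s\<bar>) = (\<Sum>s = 1..t. \<bar>p s\<bar>) + \<bar>p (Suc t)\<bar>" by simp
  ultimately show ?case
    using utility_bounded[of g p i x "Suc t" H]
      Suc.IH[of "H @ [purchasers \<sigma> (Suc t) w H - {i}]"]
    by (cases "\<delta> (Suc t) x H") (simp_all only: continuation.simps S if_True if_False, linarith+)
qed

lemma continuation_cong:
  assumes "\<And>s G. s \<le> t \<Longrightarrow> length (H @ G) + s = length H + t \<Longrightarrow> \<delta> s x (H @ G) = \<delta>' s x (H @ G)"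
    and "\<And>j s y G. s \<le> t \<Longrightarrow> length (H @ G) + s = length H + t \<Longrightarrow> \<sigma> j s y (H @ G) = \<sigma>' j s y (H @ G)"
  shows "continuation g p \<sigma> \<delta> i x t w H = continuation g p \<sigma>' \<delta>' i x t w H"
  using assms
proof (induction t arbitrary: H)
  case (Suc t)
  have "\<delta> (Suc t) x H = \<delta>' (Suc t) x H" using Suc.prems(1)[of "Suc t" "[]"] by simp
  moreover have P: "purchasers \<sigma> (Suc t) w H = purchasers \<sigma>' (Suc t) w H"
    using Suc.prems(2)[of "Suc t" "[]"] by (simp add: purchasers_def)
  moreover have "continuation g p \<sigma> \<delta> i x t w (H @ [h]) = continuation g p \<sigma>' \<delta>' i x t w (H @ [h])" for h
    by (rule Suc.IH) (use Suc.prems(1)[of _ "h # _"] Suc.prems(2)[of _ "h # _"] in auto)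
  ultimately show ?case by simp
qed simp

text \<open>Imitation induces the same play, and the valuation enters the payoff only through the
  single purchase, with slope one.\<close>

lemma continuation_lipschitz:
  assumes "\<And>s G. \<delta>' s y G = \<delta> s x G"
  shows "\<bar>continuation g p \<sigma> \<delta>' i y t w H - continuation g p \<sigma> \<delta> i x t w H\<bar> \<le> \<bar>y - x\<bar>"
  using assms by (induction t arbitrary: H) (auto simp: utility_def)

section \<open>Expectations and waiting values under a belief\<close>

definition admissible :: "real measure \<Rightarrow> 'b::finite \<Rightarrow> ('b \<Rightarrow> real) measure \<Rightarrow> bool" where
  "admissible F i M \<longleftrightarrow>
     prob_space M \<and> sets M = sets (PiM (UNIV - {i}) (\<lambda>_. F)) \<and>
     (AE w in M. \<forall>j \<in> UNIV - {i}. w j \<in> {0..1})"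

definition measurable_profile :: "'b profile \<Rightarrow> bool" where
  "measurable_profile \<sigma> \<longleftrightarrow> (\<forall>i t H. {x. \<sigma> i t x H} \<in> sets borel)"

context
  fixes F :: "real measure" and \<sigma> :: "'b::finite profile" and M :: "('b \<Rightarrow> real) measure" and i :: 'b
  assumes borel: "sets F = sets borel" and meas: "measurable_profile \<sigma>" and adm: "admissible F i M"
begin

lemma purchasers_event: "{w \<in> space M. purchasers \<sigma> t w H - {i} = h} \<in> sets M"
proof -
  have S: "sets M = sets (PiM (UNIV - {i}) (\<lambda>_. F))" using adm by (simp add: admissible_def)
  have E: "{w \<in> space M. \<sigma> j t (w j) H} \<in> sets M" if "j \<noteq> i" for j
  proof -
    have "(\<lambda>w. w j) \<in> PiM (UNIV - {i}) (\<lambda>_. F) \<rightarrow>\<^sub>M F"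
      using that by (intro measurable_component_singleton) auto
    then have m: "(\<lambda>w. w j) \<in> M \<rightarrow>\<^sub>M borel"
      by (simp only: measurable_cong_sets[OF S borel[symmetric]])
    have "{x. \<sigma> j t x H} \<in> sets borel" using meas by (simp add: measurable_profile_def)
    from measurable_sets[OF m this] show ?thesis
      by (simp add: vimage_def Int_def conj_commute)
  qed
  have "{w \<in> space M. purchasers \<sigma> t w H - {i} = h} =
    {w \<in> space M. \<forall>j\<in>UNIV. j \<in> h \<longleftrightarrow> j \<noteq> i \<and> j \<notin> bought H \<and> \<sigma> j t (w j) H}"
    by (auto simp: purchasers_def)
  also have "\<dots> \<in> sets M"
  proof (rule sets.sets_Collect_finite_All')
    fix j :: 'b
    show "{w \<in> space M. j \<in> h \<longleftrightarrow> j \<noteq> i \<and> j \<notin> bought H \<and> \<sigma> j t (w j) H} \<in> sets M"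
    proof (cases "j = i \<or> j \<in> bought H")
      case True then show ?thesis by (cases "j \<in> h") auto
    next
      case False
      have "{w \<in> space M. j \<in> h \<longleftrightarrow> j \<noteq> i \<and> j \<notin> bought H \<and> \<sigma> j t (w j) H} =
        (if j \<in> h then {w \<in> space M. \<sigma> j t (w j) H} else space M - {w \<in> space M. \<sigma> j t (w j) H})"
        using False by auto
      then show ?thesis using E[of j] False by auto
    qed
  qed auto
  finally show ?thesis .
qed

text \<open>The next history is determined by the set of buyers, which takes finitely many values,
  each on a measurable event.\<close>

lemma continuation_measurable [measurable]: "(\<lambda>w. continuation g p \<sigma> \<delta> i x t w H) \<in> borel_measurable M"
proof (induction t arbitrary: H)
  case (Suc t)
  have "(\<lambda>w. purchasers \<sigma> (Suc t) w H - {i}) \<in> M \<rightarrow>\<^sub>M count_space UNIV"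
    using purchasers_event[of "Suc t" H]
    by (auto simp: measurable_count_space_eq2 vimage_def Int_def conj_commute)
  then have "(\<lambda>w. continuation g p \<sigma> \<delta> i x t w (H @ [purchasers \<sigma> (Suc t) w H - {i}])) \<in> borel_measurable M"
    using Suc.IH by (rule measurable_compose_countable[rotated])
  then show ?case by (cases "\<delta> (Suc t) x H") simp_all
qed simp

lemma continuation_integrable: "integrable M (\<lambda>w. continuation g p \<sigma> \<delta> i x t w H)"
proof -
  interpret prob_space M using adm by (simp add: admissible_def)
  show ?thesis
    by (rule integrable_const_bound[OF AE_I2 continuation_measurable]) (simp only: real_norm_def, rule continuation_bounded)
qed

text \<open>The bound is uniform in \<open>\<delta>\<close>, so the supremum in
  \<open>waiting_value\<close> is taken over a set bounded above.\<close>

lemma expected_payoff_bounded: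
  "i \<notin> bought H \<Longrightarrow>
     expected_payoff g p \<sigma> M i x t H \<delta> \<le> \<bar>x\<bar> + (\<Sum>s = 1..t. \<bar>p s\<bar>) + (\<Sum>j\<in>UNIV. \<bar>g i j\<bar>)"
proof -
  interpret prob_space M using adm by (simp add: admissible_def)
  assume "i \<notin> bought H"
  moreover have "(\<integral>w. continuation g p \<sigma> \<delta> i x t w H \<partial>M) \<le> \<bar>x\<bar> + (\<Sum>s = 1..t. \<bar>p s\<bar>) + (\<Sum>j\<in>UNIV. \<bar>g i j\<bar>)"
    by (rule integral_le_const[OF continuation_integrable])
      (use continuation_bounded[of g p \<sigma> \<delta> i x t _ H] in \<open>auto intro!: AE_I2 simp: abs_le_iff\<close>)
  ultimately show ?thesis by (simp add: expected_payoff_eq_continuation)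
qed

lemma expected_payoff_le_waiting_value:
  assumes "i \<notin> bought H" "\<not> \<delta> t x H"
  shows "expected_payoff g p \<sigma> M i x t H \<delta> \<le> waiting_value g p \<sigma> M i x t H"
proof -
  have "bdd_above (expected_payoff g p \<sigma> M i x t H ` {\<delta>. \<not> \<delta> t x H})"
    using expected_payoff_bounded[OF assms(1)] by (rule bdd_aboveI2)
  moreover have "\<delta> \<in> {\<delta>. \<not> \<delta> t x H}" using assms(2) by simp
  ultimately show ?thesis unfolding waiting_value_def by (rule cSUP_upper[rotated])
qed

lemma expected_payoff_ge:
  assumes "i \<notin> bought H" "\<And>w. c \<le> continuation g p \<sigma> \<delta> i x t w H"
  shows "c \<le> expected_payoff g p \<sigma> M i x t H \<delta>"
proof -
  interpret prob_space M using adm by (simp add: admissible_def)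
  have "c \<le> (\<integral>w. continuation g p \<sigma> \<delta> i x t w H \<partial>M)"
    by (rule integral_ge_const[OF continuation_integrable]) (use assms(2) in auto)
  then show ?thesis using assms(1) by (simp add: expected_payoff_eq_continuation)
qed

lemma expected_payoff_mono:
  assumes "i \<notin> bought H" "\<And>w. continuation g p \<sigma> \<delta> i x t w H \<le> continuation g p \<sigma> \<delta>' i x t w H"
  shows "expected_payoff g p \<sigma> M i x t H \<delta> \<le> expected_payoff g p \<sigma> M i x t H \<delta>'"
proof -
  have "(\<integral>w. continuation g p \<sigma> \<delta> i x t w H \<partial>M) \<le> (\<integral>w. continuation g p \<sigma> \<delta>' i x t w H \<partial>M)"
    using continuation_integrable continuation_integrable assms(2) by (rule integral_mono)
  then show ?thesis by (simp only: expected_payoff_eq_continuation[OF assms(1)])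
qed

text \<open>Valuation \<open>x\<close> can imitate any waiting plan of \<open>y\<close>. The
  imitation waits as well, and the two payoffs differ by at most the distance of the
  valuations.\<close>

lemma waiting_value_lipschitz:
  assumes "i \<notin> bought H"
  shows "waiting_value g p \<sigma> M i y t H \<le> waiting_value g p \<sigma> M i x t H + \<bar>y - x\<bar>"
proof -
  interpret prob_space M using adm by (simp add: admissible_def)
  have "expected_payoff g p \<sigma> M i y t H \<delta> \<le> waiting_value g p \<sigma> M i x t H + \<bar>y - x\<bar>"
    if "\<not> \<delta> t y H" for \<delta>
  proof -
    let ?\<delta> = "\<lambda>s _ G. \<delta> s y G"
    have "(\<integral>w. continuation g p \<sigma> \<delta> i y t w H \<partial>M) \<le> (\<integral>w. continuation g p \<sigma> ?\<delta> i x t w H + \<bar>y - x\<bar> \<partial>M)"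
    proof (rule integral_mono)
      fix w
      show "continuation g p \<sigma> \<delta> i y t w H \<le> continuation g p \<sigma> ?\<delta> i x t w H + \<bar>y - x\<bar>"
      proof -
        have "\<bar>continuation g p \<sigma> \<delta> i y t w H - continuation g p \<sigma> ?\<delta> i x t w H\<bar> \<le> \<bar>y - x\<bar>"
          by (rule continuation_lipschitz) simp
        then show ?thesis by linarith
      qed
    qed (intro continuation_integrable Bochner_Integration.integrable_add integrable_const)+
    also have "\<dots> = (\<integral>w. continuation g p \<sigma> ?\<delta> i x t w H \<partial>M) + \<bar>y - x\<bar>"
      by (subst Bochner_Integration.integral_add) (simp_all add: continuation_integrable prob_space)
    also have "\<dots> \<le> waiting_value g p \<sigma> M i x t H + \<bar>y - x\<bar>"
      using expected_payoff_le_waiting_value[OF assms, of ?\<delta> t x g p] that assms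
      by (simp add: expected_payoff_eq_continuation)
    finally show ?thesis using assms by (simp add: expected_payoff_eq_continuation)
  qed
  moreover have "{\<delta>. \<not> \<delta> t y H} \<noteq> {}" by (auto intro!: exI[of _ "\<lambda>_ _ _. False"])
  ultimately show ?thesis unfolding waiting_value_def[of g p \<sigma> M i y] by (intro cSUP_least) auto
qed

text \<open>The gain \<open>D\<close> from buying at once is nondecreasing, as utility has slope one
  and the waiting value is 1-Lipschitz. It is also continuous, so the set where it is nonnegative
  contains its infimum; hence the weak inequality \<open>x \<ge> \<tau>\<close>.\<close>

lemma purchase_threshold:
  assumes "i \<notin> bought H"
  shows "\<exists>\<tau>. \<forall>x \<in> {0..1}. utility g p i x t H \<ge> waiting_value g p \<sigma> M i x t H \<longleftrightarrow> x \<ge> \<tau>"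
proof -
  define D where "D x = utility g p i x t H - waiting_value g p \<sigma> M i x t H" for x
  have mono: "D x \<le> D y" if "x \<le> y" for x y
    using waiting_value_lipschitz[OF assms, of g p y t x] that by (simp add: D_def utility_def)
  have "2-lipschitz_on UNIV D"
  proof (rule lipschitz_onI)
    fix x y
    show "dist (D x) (D y) \<le> 2 * dist x y"
      using waiting_value_lipschitz[OF assms, of g p y t x] waiting_value_lipschitz[OF assms, of g p x t y]
      by (cases "x \<le> y") (auto simp: D_def utility_def dist_real_def abs_le_iff)
  qed simp
  then have Dcont: "continuous_on UNIV D" by (rule lipschitz_on_continuous_on)
  let ?S = "{x \<in> {0..1}. D x \<ge> 0}"
  have "?S = {0..1} \<inter> {x. 0 \<le> D x}" by auto
  moreover have "closed ({0..1} \<inter> {x. 0 \<le> D x})"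
    by (intro closed_Int closed_Collect_le Dcont continuous_on_const) auto
  ultimately have cl: "closed ?S" by simp
  show ?thesis
  proof (cases "?S = {}")
    case True
    \<comment> \<open>Nobody buys, so any number above 1 is a threshold.\<close>
    then show ?thesis by (intro exI[of _ 2]) (auto simp: D_def)
  next
    case False
    have bdd: "bdd_below ?S" by (rule bdd_belowI[of _ 0]) auto
    have "Inf ?S \<in> ?S" by (rule closed_contains_Inf[OF False bdd cl])
    then have "x \<in> {0..1} \<Longrightarrow> D x \<ge> 0 \<longleftrightarrow> x \<ge> Inf ?S" for x
      using mono[of "Inf ?S" x] cInf_lower[OF _ bdd, of x] by auto
    then show ?thesis by (intro exI[of _ "Inf ?S"]) (auto simp: D_def)
  qed
qed

end

section \<open>Rationality at a single history\<close>

lemma histories_snoc: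
  assumes "H \<in> histories T (Suc t)" "Suc t \<le> T"
  shows "H @ [h] \<in> histories T t \<longleftrightarrow> h \<inter> bought H = {}"
proof -
  have len: "length H = T - Suc t" using assms by (simp add: histories_def)
  have "h \<inter> bought H = {} \<longleftrightarrow> (\<forall>l < length H. h \<inter> H ! l = {})"
    by (fastforce simp: bought_def in_set_conv_nth)
  then show ?thesis
    using assms len by (auto simp: histories_def nth_append less_Suc_eq)
qed

lemma histories_length: "H \<in> histories T t \<Longrightarrow> length H = T - t"
  by (simp add: histories_def)

text \<open>The demands of an equilibrium on one buyer at one history. Bayes' rule is phrased with
  \<open>h \<inter> bought H = {}\<close> instead of membership in \<open>histories\<close>, so that
  the condition does not mention \<open>T\<close>. At \<open>t = 0\<close> only the admissibility of
  the belief remains.\<close>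

definition rational_at ::
  "('b::finite \<Rightarrow> 'b \<Rightarrow> real) \<Rightarrow> real measure \<Rightarrow> (nat \<Rightarrow> real) \<Rightarrow> 'b profile \<Rightarrow>
   ('b \<Rightarrow> 'b history \<Rightarrow> ('b \<Rightarrow> real) measure) \<Rightarrow> 'b \<Rightarrow> nat \<Rightarrow> 'b history \<Rightarrow> bool"
where
  "rational_at g F p \<sigma> \<mu> i t H \<longleftrightarrow>
     admissible F i (\<mu> i H) \<and>
     (1 \<le> t \<and> i \<notin> bought H \<longrightarrow>
        (\<forall>h. h \<inter> bought H = {} \<and> i \<notin> h \<longrightarrow>
           measure (\<mu> i H) {w \<in> space (\<mu> i H). purchasers \<sigma> t w H - {i} = h} > 0 \<longrightarrow>
           \<mu> i (H @ [h]) =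
             uniform_measure (\<mu> i H) {w \<in> space (\<mu> i H). purchasers \<sigma> t w H - {i} = h}) \<and>
        (\<forall>x \<in> {0..1}.
           (\<forall>\<delta>. expected_payoff g p \<sigma> (\<mu> i H) i x t H \<delta>
                 \<le> expected_payoff g p \<sigma> (\<mu> i H) i x t H (\<sigma> i)) \<and>
           (\<sigma> i t x H \<longleftrightarrow> utility g p i x t H \<ge> waiting_value g p \<sigma> (\<mu> i H) i x t H)))"

lemma equilibrium_iff:
  fixes \<sigma> :: "'b::finite profile"
  shows "equilibrium T g F p \<sigma> \<longleftrightarrow>
     measurable_profile \<sigma> \<and>
     (\<exists>\<mu>. (\<forall>i. \<mu> i [] = PiM (UNIV - {i}) (\<lambda>_. F)) \<and>
        (\<forall>i. \<forall>t \<le> T. \<forall>H \<in> histories T t. rational_at g F p \<sigma> \<mu> i t H))"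
proof -
  have snoc: "H @ [h] \<in> histories T (t - 1) \<longleftrightarrow> h \<inter> bought H = {}"
    if "t \<in> {1..T}" "H \<in> histories T t" for t H and h :: "'b set"
    using histories_snoc[of H T "t - 1" h] that by auto
  have "bayesian_beliefs T F \<sigma> \<mu> \<and>
        (\<forall>i. \<forall>t \<in> {1..T}. \<forall>H \<in> histories T t. \<forall>x \<in> {0..1}. i \<notin> bought H \<longrightarrow>
           (\<forall>\<delta>. expected_payoff g p \<sigma> (\<mu> i H) i x t H \<delta>
                 \<le> expected_payoff g p \<sigma> (\<mu> i H) i x t H (\<sigma> i)) \<and>
           (\<sigma> i t x H \<longleftrightarrow> utility g p i x t H \<ge> waiting_value g p \<sigma> (\<mu> i H) i x t H))
    \<longleftrightarrow> (\<forall>i. \<mu> i [] = PiM (UNIV - {i}) (\<lambda>_. F)) \<and>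
        (\<forall>i. \<forall>t \<le> T. \<forall>H \<in> histories T t. rational_at g F p \<sigma> \<mu> i t H)"
    (is "?L \<longleftrightarrow> ?R") for \<mu> :: "'b \<Rightarrow> 'b history \<Rightarrow> ('b \<Rightarrow> real) measure"
  proof
    assume L: ?L
    then have B: "bayesian_beliefs T F \<sigma> \<mu>" ..
    show ?R
    proof (intro conjI allI impI ballI)
      fix i show "\<mu> i [] = PiM (UNIV - {i}) (\<lambda>_. F)" using B by (simp add: bayesian_beliefs_def)
    next
      fix i t and H :: "'b history" assume t: "t \<le> T" and H: "H \<in> histories T t"
      have "admissible F i (\<mu> i H)"
        using B t H unfolding bayesian_beliefs_def admissible_def by blast
      moreover have "\<mu> i (H @ [h]) =
             uniform_measure (\<mu> i H) {w \<in> space (\<mu> i H). purchasers \<sigma> t w H - {i} = h}"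
        if "1 \<le> t" "i \<notin> bought H" "h \<inter> bought H = {}" "i \<notin> h"
           "measure (\<mu> i H) {w \<in> space (\<mu> i H). purchasers \<sigma> t w H - {i} = h} > 0" for h
      proof -
        have t1: "t \<in> {1..T}" using t that by simp
        have "H @ [h] \<in> histories T (t - 1) \<and> i \<notin> bought (H @ [h])"
          using that snoc[OF t1 H] by simp
        then show ?thesis using B t1 H that(5) unfolding bayesian_beliefs_def Let_def by blast
      qed
      moreover have "\<forall>x \<in> {0..1}.
           (\<forall>\<delta>. expected_payoff g p \<sigma> (\<mu> i H) i x t H \<delta>
                 \<le> expected_payoff g p \<sigma> (\<mu> i H) i x t H (\<sigma> i)) \<and>
           (\<sigma> i t x H \<longleftrightarrow> utility g p i x t H \<ge> waiting_value g p \<sigma> (\<mu> i H) i x t H)"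
        if "1 \<le> t" "i \<notin> bought H"
        using L t H that by simp
      ultimately show "rational_at g F p \<sigma> \<mu> i t H" unfolding rational_at_def by blast
    qed
  next
    assume R: ?R
    have "bayesian_beliefs T F \<sigma> \<mu>"
      unfolding bayesian_beliefs_def Let_def
    proof (intro conjI allI impI ballI)
      fix i t and H :: "'b history" and h assume t: "t \<in> {1..T}" and H: "H \<in> histories T t"
        and h: "H @ [h] \<in> histories T (t - 1) \<and> i \<notin> bought (H @ [h])"
        and pos: "measure (\<mu> i H) {w \<in> space (\<mu> i H). purchasers \<sigma> t w H - {i} = h} > 0"
      have "rational_at g F p \<sigma> \<mu> i t H" using R t H by simp
      moreover have "1 \<le> t" "i \<notin> bought H" "h \<inter> bought H = {}" "i \<notin> h"
        using t h snoc[OF t H] by auto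
      ultimately show "\<mu> i (H @ [h]) =
             uniform_measure (\<mu> i H) {w \<in> space (\<mu> i H). purchasers \<sigma> t w H - {i} = h}"
        using pos unfolding rational_at_def by blast
    next
      fix i show "\<mu> i [] = PiM (UNIV - {i}) (\<lambda>_. F)" using R by blast
    next
      fix i t and H :: "'b history" assume "t \<le> T" "H \<in> histories T t"
      then have "admissible F i (\<mu> i H)" using R by (simp add: rational_at_def)
      then show "prob_space (\<mu> i H)" "sets (\<mu> i H) = sets (PiM (UNIV - {i}) (\<lambda>_. F))"
        "AE w in \<mu> i H. \<forall>j \<in> UNIV - {i}. w j \<in> {0..1}"
        unfolding admissible_def by auto
    qed
    then show ?L using R by (auto simp: rational_at_def)
  qed
  then show ?thesis unfolding equilibrium_def measurable_profile_def by presburger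
qed

lemma expected_payoff_cong:
  assumes "i \<notin> bought H" "\<And>j s y G. \<sigma> j s y (H @ G) = \<sigma>' j s y (H @ G)"
    and "\<And>s x G. \<delta> s x (H @ G) = \<delta>' s x (H @ G)"
  shows "expected_payoff g p \<sigma> M i x t H \<delta> = expected_payoff g p \<sigma>' M i x t H \<delta>'"
  unfolding expected_payoff_eq_continuation[OF assms(1)]
  by (intro Bochner_Integration.integral_cong refl continuation_cong assms)

text \<open>Only \<open>H\<close> and its extensions are consulted, so profile and beliefs may be
  altered elsewhere at will. This is the principle by which off-path play is glued in.\<close>

lemma rational_at_cong:
  assumes \<mu>: "\<And>G. \<mu> i (H @ G) = \<mu>' i (H @ G)"
    and \<sigma>: "\<And>j s y G. \<sigma> j s y (H @ G) = \<sigma>' j s y (H @ G)"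
  shows "rational_at g F p \<sigma> \<mu> i t H \<longleftrightarrow> rational_at g F p \<sigma>' \<mu>' i t H"
proof (cases "i \<in> bought H")
  case True
  then show ?thesis using \<mu>[of "[]"] by (simp add: rational_at_def)
next
  case False
  have P: "purchasers \<sigma> t w H = purchasers \<sigma>' t w H" for w
    using \<sigma>[of _ _ _ "[]"] by (simp add: purchasers_def)
  have E: "expected_payoff g p \<sigma> M i x t H \<delta> = expected_payoff g p \<sigma>' M i x t H \<delta>" for M x \<delta>
    by (rule expected_payoff_cong[OF False]) (simp_all add: \<sigma>)
  have E': "expected_payoff g p \<sigma>' M i x t H (\<sigma> i) = expected_payoff g p \<sigma>' M i x t H (\<sigma>' i)" for M x
    by (rule expected_payoff_cong[OF False]) (simp_all add: \<sigma>)
  show ?thesis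
    using \<mu>[of "[]"] \<sigma>[of _ _ _ "[]"] unfolding rational_at_def waiting_value_def P E E'
    by (simp add: \<mu>)
qed

section \<open>Idle rounds\<close>

text \<open>
  A price above this one makes buying at round \<open>d\<close> strictly worse than buying at the next live round
  or, if there is none, than not buying at all.
\<close>

definition reserve_price ::
  "('b::finite \<Rightarrow> 'b \<Rightarrow> real) \<Rightarrow> (nat \<Rightarrow> real) \<Rightarrow> nat set \<Rightarrow> nat \<Rightarrow> real" where
  "reserve_price g p R d =
     (if R \<inter> {..<d} = {} then 1 + (\<Sum>i\<in>UNIV. \<Sum>j\<in>UNIV. g i j) else p (Max (R \<inter> {..<d})))"

definition idle_outside ::
  "nat \<Rightarrow> ('b::finite \<Rightarrow> 'b \<Rightarrow> real) \<Rightarrow> (nat \<Rightarrow> real) \<Rightarrow> nat set \<Rightarrow> bool" where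
  "idle_outside T g p R \<longleftrightarrow>
     R \<subseteq> {1..T} \<and> (\<forall>i j. 0 \<le> g i j) \<and> (\<forall>d \<in> {1..T} - R. reserve_price g p R d < p d)"

lemma externality_le_total:
  fixes g :: "'b::finite \<Rightarrow> 'b \<Rightarrow> real"
  assumes "\<And>i j. 0 \<le> g i j"
  shows "(\<Sum>j \<in> UNIV - {i}. g i j * of_bool (j \<in> B)) \<le> (\<Sum>i\<in>UNIV. \<Sum>j\<in>UNIV. g i j)"
proof -
  have "(\<Sum>j \<in> UNIV - {i}. g i j * of_bool (j \<in> B)) \<le> (\<Sum>j \<in> UNIV - {i}. g i j)"
    by (intro sum_mono) (use assms in auto)
  also have "\<dots> \<le> (\<Sum>j \<in> UNIV. g i j)" by (intro sum_mono2) (use assms in auto)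
  also have "\<dots> \<le> (\<Sum>i\<in>UNIV. \<Sum>j\<in>UNIV. g i j)"
    by (rule member_le_sum[where f = "\<lambda>i. \<Sum>j\<in>UNIV. g i j"]) (use assms in \<open>auto intro: sum_nonneg\<close>)
  finally show ?thesis .
qed

lemma externality_mono:
  fixes g :: "'b::finite \<Rightarrow> 'b \<Rightarrow> real"
  assumes "\<And>i j. 0 \<le> g i j" "A \<subseteq> B"
  shows "(\<Sum>j \<in> UNIV - {i}. g i j * of_bool (j \<in> A)) \<le> (\<Sum>j \<in> UNIV - {i}. g i j * of_bool (j \<in> B))"
  by (intro sum_mono) (use assms in auto)

text \<open>No live round has been passed since \<open>d\<close>, so the plan buys at the next one,
  at price \<open>reserve_price\<close>, with an externality that has not shrunk. If no live round
  is left the plan earns 0, while \<open>1\<close> plus the sum of all weights bounds valuation plus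
  externality at \<open>d\<close>.\<close>

lemma continuation_buy_when_live:
  assumes "idle_outside T g p R" "d \<in> {1..T} - R" "x \<le> 1"
    and "t < d" "\<And>s. s \<in> R \<Longrightarrow> s < d \<Longrightarrow> s \<le> t" "bought G \<subseteq> bought H"
  shows "utility g p i x d G + (p d - reserve_price g p R d)
           \<le> continuation g p \<sigma> (\<lambda>s _ _. s \<in> R) i x t w H"
  using assms(4-)
proof (induction t arbitrary: H)
  case 0
  have "R \<inter> {..<d} = {}" using 0 assms(1) by (force simp: idle_outside_def)
  then show ?case
    using externality_le_total[of g i "bought G"] assms(1,3)
    by (simp add: reserve_price_def utility_def idle_outside_def)
next
  case (Suc t)
  show ?case
  proof (cases "Suc t \<in> R")
    case True
    have "Max (R \<inter> {..<d}) = Suc t" using True Suc.prems by (intro Max_eqI) auto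
    moreover have "R \<inter> {..<d} \<noteq> {}" using True Suc.prems by auto
    ultimately have "reserve_price g p R d = p (Suc t)" by (simp add: reserve_price_def)
    then show ?thesis
      using True externality_mono[of g "bought G" "bought H" i] assms(1) Suc.prems(3)
      by (simp add: utility_def idle_outside_def)
  next
    case False
    have "s \<le> t" if "s \<in> R" "s < d" for s
      using Suc.prems(2)[OF that] that False by (cases "s = Suc t") auto
    then have "utility g p i x d G + (p d - reserve_price g p R d)
      \<le> continuation g p \<sigma> (\<lambda>s _ _. s \<in> R) i x t w (H @ [purchasers \<sigma> (Suc t) w H - {i}])"
      by (rule Suc.IH[rotated]) (use Suc.prems in auto)
    then show ?thesis using False by simp
  qed
qed

text \<open>
  Every purchase that \<open>\<delta>\<close> makes at an idle round is put off until the next live round; \<open>n\<close> is the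
  length of the history from which the play is considered.
\<close>

definition postpone :: "nat \<Rightarrow> nat set \<Rightarrow> nat \<Rightarrow> 'b strategy \<Rightarrow> 'b strategy" where
  "postpone T R n \<delta> t x H \<longleftrightarrow>
     t \<in> R \<and> (\<delta> t x H \<or> (\<exists>k \<in> {n..<length H}. T - k \<notin> R \<and> \<delta> (T - k) x (take k H)))"

text \<open>A pending purchase stays pending as the history grows, so from then on the first live
  round is taken whatever \<open>\<delta>\<close> says.\<close>

lemma continuation_postpone_pending:
  assumes "\<exists>k \<in> {n..<length H}. T - k \<notin> R \<and> \<delta> (T - k) x (take k H)"
  shows "continuation g p \<sigma> (postpone T R n \<delta>) i x t w H =
         continuation g p \<sigma> (\<lambda>s _ _. s \<in> R) i x t w H"
  using assms
proof (induction t arbitrary: H)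
  case (Suc t)
  have "\<exists>k \<in> {n..<length (H @ [h])}. T - k \<notin> R \<and> \<delta> (T - k) x (take k (H @ [h]))" for h
  proof -
    obtain k where "k \<in> {n..<length H}" "T - k \<notin> R" "\<delta> (T - k) x (take k H)"
      using Suc.prems by blast
    then show ?thesis by (intro bexI[of _ k]) auto
  qed
  then show ?case using Suc by (simp add: postpone_def)
qed simp

text \<open>Both plans act alike until \<open>\<delta>\<close> buys at an idle round. From there the
  postponed plan buys at the next live round, which by \<open>continuation_buy_when_live\<close> is
  at least as good.\<close>

lemma continuation_le_postpone:
  assumes "idle_outside T g p R" "x \<le> 1"
    and "length H = T - t" "t \<le> T" "n \<le> length H" "i \<notin> bought H"
    and "\<not> (\<exists>k \<in> {n..<length H}. T - k \<notin> R \<and> \<delta> (T - k) x (take k H))"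
  shows "continuation g p \<sigma> \<delta> i x t w H \<le> continuation g p \<sigma> (postpone T R n \<delta>) i x t w H"
  using assms(3-)
proof (induction t arbitrary: H)
  case (Suc t)
  let ?G = "H @ [purchasers \<sigma> (Suc t) w H - {i}]"
  \<comment> \<open>A history of length \<open>k\<close> precedes round \<open>T - k\<close>, so the
    current decision becomes the entry \<open>k = length H\<close> of the pending condition one
    round later.\<close>
  have now: "T - length H = Suc t" using Suc.prems by simp
  have pending_snoc: "(\<exists>k \<in> {n..<length ?G}. T - k \<notin> R \<and> \<delta> (T - k) x (take k ?G)) \<longleftrightarrow>
    Suc t \<notin> R \<and> \<delta> (Suc t) x H"
  proof -
    have "{n..<length ?G} = insert (length H) {n..<length H}" using Suc.prems by auto
    then show ?thesis using Suc.prems(5) now by auto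
  qed
  have IH: "continuation g p \<sigma> \<delta> i x t w ?G \<le> continuation g p \<sigma> (postpone T R n \<delta>) i x t w ?G"
    if "\<not> (Suc t \<notin> R \<and> \<delta> (Suc t) x H)"
    by (rule Suc.IH) (use Suc.prems that pending_snoc in auto)
  have live: "postpone T R n \<delta> (Suc t) x H \<longleftrightarrow> Suc t \<in> R \<and> \<delta> (Suc t) x H"
    using Suc.prems(5) unfolding postpone_def by blast
  show ?case
  proof (cases "Suc t \<notin> R \<and> \<delta> (Suc t) x H")
    case False
    then show ?thesis using IH live by auto
  next
    case True
    have d: "Suc t \<in> {1..T} - R" using True Suc.prems by simp
    have "utility g p i x (Suc t) H \<le>
      utility g p i x (Suc t) H + (p (Suc t) - reserve_price g p R (Suc t))"
      using assms(1) d unfolding idle_outside_def by force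
    also have "\<dots> \<le> continuation g p \<sigma> (\<lambda>s _ _. s \<in> R) i x t w ?G"
      by (rule continuation_buy_when_live[OF assms(1) d assms(2)]) auto
    also have "\<dots> = continuation g p \<sigma> (postpone T R n \<delta>) i x t w ?G"
      by (rule continuation_postpone_pending[symmetric]) (use pending_snoc True in blast)
    finally show ?thesis using True live by simp
  qed
qed simp

text \<open>Buying at the next live round is a plan that waits now and gains the positive price gap.
  Strictness matters because an indifferent buyer would buy.\<close>

lemma idle_waiting_value_gt:
  assumes "sets F = sets borel" "measurable_profile \<sigma>" "admissible F i M"
    and "idle_outside T g p R" "t \<in> {1..T} - R" "i \<notin> bought H" "x \<le> 1"
  shows "utility g p i x t H < waiting_value g p \<sigma> M i x t H"
proof -
  let ?\<delta> = "\<lambda>s _ _. s \<in> R"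
  obtain s where s: "t = Suc s" using assms(5) by (cases t) auto
  have "utility g p i x t H < utility g p i x t H + (p t - reserve_price g p R t)"
    using assms(4,5) unfolding idle_outside_def by force
  also have "\<dots> \<le> expected_payoff g p \<sigma> M i x t H ?\<delta>"
  proof (rule expected_payoff_ge[OF assms(1-3,6)])
    fix w
    have "utility g p i x t H + (p t - reserve_price g p R t)
      \<le> continuation g p \<sigma> ?\<delta> i x s w (H @ [purchasers \<sigma> t w H - {i}])"
      by (rule continuation_buy_when_live[OF assms(4,5,7)]) (use s in auto)
    then show "utility g p i x t H + (p t - reserve_price g p R t) \<le> continuation g p \<sigma> ?\<delta> i x t w H"
      using s assms(5) by simp
  qed
  also have "\<dots> \<le> waiting_value g p \<sigma> M i x t H"
    by (rule expected_payoff_le_waiting_value[OF assms(1-3,6)]) (use assms(5) in simp)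
  finally show ?thesis .
qed

section \<open>Re-timing the live rounds\<close>

text \<open>
  \<open>H\<close> (before round \<open>t\<close> of the first game) and \<open>H'\<close> (before round \<open>t'\<close> of the second) have the same
  purchases at corresponding live rounds and no purchases at idle rounds.
\<close>

definition aligned ::
  "nat \<Rightarrow> nat set \<Rightarrow> nat set \<Rightarrow> (nat \<Rightarrow> nat) \<Rightarrow> nat \<Rightarrow> 'b history \<Rightarrow> nat \<Rightarrow> 'b history \<Rightarrow> bool" where
  "aligned T R R' \<rho> t H t' H' \<longleftrightarrow>
     t \<le> T \<and> t' \<le> T \<and> H \<in> histories T t \<and> H' \<in> histories T t' \<and>
     (\<forall>r \<in> R. t < r \<longleftrightarrow> t' < \<rho> r) \<and>
     (\<forall>r \<in> R. t < r \<longrightarrow> H ! (T - r) = H' ! (T - \<rho> r)) \<and>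
     (\<forall>s \<in> {t<..T} - R. H ! (T - s) = {}) \<and>
     (\<forall>s \<in> {t'<..T} - R'. H' ! (T - s) = {})"

text \<open>Stated for a single valuation, because an equilibrium controls play only for valuations
  in \<open>{0..1}\<close> and a deviation is examined only at the deviator's own valuation.\<close>

definition agree ::
  "nat \<Rightarrow> nat set \<Rightarrow> nat set \<Rightarrow> (nat \<Rightarrow> nat) \<Rightarrow> 'b strategy \<Rightarrow> 'b strategy \<Rightarrow> real \<Rightarrow> 'b \<Rightarrow> bool" where
  "agree T R R' \<rho> a a' y i \<longleftrightarrow>
     (\<forall>t H t' H'. aligned T R R' \<rho> t H t' H' \<and> i \<notin> bought H \<longrightarrow>
        (t \<in> R \<and> t' = \<rho> t \<longrightarrow> a t y H = a' t' y H') \<and>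
        (t \<in> {1..T} - R \<longrightarrow> \<not> a t y H) \<and>
        (t' \<in> {1..T} - R' \<longrightarrow> \<not> a' t' y H'))"

lemma agreeD:
  assumes "agree T R R' \<rho> a a' y i" "aligned T R R' \<rho> t H t' H'" "i \<notin> bought H"
  shows "t \<in> R \<Longrightarrow> t' = \<rho> t \<Longrightarrow> a t y H \<longleftrightarrow> a' t' y H'"
    and "t \<in> {1..T} - R \<Longrightarrow> \<not> a t y H"
    and "t' \<in> {1..T} - R' \<Longrightarrow> \<not> a' t' y H'"
  using assms unfolding agree_def by blast+

definition retime :: "nat \<Rightarrow> nat set \<Rightarrow> (nat \<Rightarrow> nat) \<Rightarrow> nat \<Rightarrow> 'b history \<Rightarrow> 'b history" where
  "retime T R \<rho> t H' = map (\<lambda>k. if T - k \<in> R then H' ! (T - \<rho> (T - k)) else {}) [0..<T - t]"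

locale retiming =
  fixes T :: nat and g :: "'b::finite \<Rightarrow> 'b \<Rightarrow> real" and p p' :: "nat \<Rightarrow> real"
    and R R' :: "nat set" and \<rho> \<rho>' :: "nat \<Rightarrow> nat"
  assumes idle: "idle_outside T g p R" and idle': "idle_outside T g p' R'"
    and \<rho>_live: "r \<in> R \<Longrightarrow> \<rho> r \<in> R'" and \<rho>'_live: "r' \<in> R' \<Longrightarrow> \<rho>' r' \<in> R"
    and \<rho>'_\<rho>: "r \<in> R \<Longrightarrow> \<rho>' (\<rho> r) = r" and \<rho>_\<rho>': "r' \<in> R' \<Longrightarrow> \<rho> (\<rho>' r') = r'"
    and \<rho>_mono: "strict_mono_on R \<rho>"
    and price: "r \<in> R \<Longrightarrow> p' (\<rho> r) = p r"
begin

text \<open>The exchange of roles yields the second half of each two-sided statement and the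
  transfer of equilibria in the opposite direction.\<close>

lemma swap: "retiming T g p' p R' R \<rho>' \<rho>"
proof
  show "strict_mono_on R' \<rho>'"
  proof (rule strict_mono_onI)
    fix r s assume "r \<in> R'" "s \<in> R'" "r < s"
    show "\<rho>' r < \<rho>' s"
    proof (rule ccontr)
      assume "\<not> \<rho>' r < \<rho>' s"
      then have "\<rho> (\<rho>' s) \<le> \<rho> (\<rho>' r)"
        using \<open>r \<in> R'\<close> \<open>s \<in> R'\<close> by (intro strict_mono_on_leD[OF \<rho>_mono] \<rho>'_live) auto
      then show False using \<open>r \<in> R'\<close> \<open>s \<in> R'\<close> \<open>r < s\<close> \<rho>_\<rho>' by simp
    qed
  qed
  show "p (\<rho>' r) = p' r" if "r \<in> R'" for r
    using price[OF \<rho>'_live[OF that]] \<rho>_\<rho>'[OF that] by simp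
qed (use idle idle' \<rho>_live \<rho>'_live \<rho>'_\<rho> \<rho>_\<rho>' in auto)

lemma live_bounds: "r \<in> R \<Longrightarrow> 1 \<le> r \<and> r \<le> T"
  and live'_bounds: "r \<in> R' \<Longrightarrow> 1 \<le> r \<and> r \<le> T"
  using idle idle' by (auto simp: idle_outside_def)

lemma aligned_swap:
  assumes "aligned T R R' \<rho> t H t' H'"
  shows "aligned T R' R \<rho>' t' H' t H"
proof -
  have "t' < r \<longleftrightarrow> t < \<rho>' r" "t' < r \<longrightarrow> H' ! (T - r) = H ! (T - \<rho>' r)" if "r \<in> R'" for r
    using assms \<rho>'_live[OF that] \<rho>_\<rho>'[OF that] by (auto simp: aligned_def)
  then show ?thesis using assms by (simp add: aligned_def)
qed

lemma aligned_bought_subset: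
  assumes "aligned T R R' \<rho> t H t' H'"
  shows "bought H \<subseteq> bought H'"
proof
  fix j assume "j \<in> bought H"
  then obtain k where k: "k < length H" "j \<in> H ! k" by (auto simp: bought_def in_set_conv_nth)
  have len: "length H = T - t" "length H' = T - t'" using assms by (auto simp: aligned_def histories_def)
  define s where "s = T - k"
  have s: "s \<in> {t<..T}" "T - s = k" using k len by (auto simp: s_def)
  have "s \<in> R" using assms s k by (auto simp: aligned_def)
  then have "H' ! (T - \<rho> s) = H ! k" "t' < \<rho> s" using assms s by (auto simp: aligned_def)
  then show "j \<in> bought H'" using k len live'_bounds[OF \<rho>_live[OF \<open>s \<in> R\<close>]]
    by (auto simp: bought_def in_set_conv_nth intro!: bexI[of _ "H' ! (T - \<rho> s)"] exI[of _ "T - \<rho> s"])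
qed

lemma aligned_bought:
  assumes "aligned T R R' \<rho> t H t' H'"
  shows "bought H = bought H'"
proof
  show "bought H \<subseteq> bought H'" by (rule aligned_bought_subset[OF assms])
  interpret S: retiming T g p' p R' R \<rho>' \<rho> by (rule swap)
  show "bought H' \<subseteq> bought H" by (rule S.aligned_bought_subset[OF aligned_swap[OF assms]])
qed

lemma aligned_initial: "aligned T R R' \<rho> T [] T []"
  using live_bounds live'_bounds \<rho>_live by (force simp: aligned_def histories_def)

lemma aligned_skip:
  assumes "aligned T R R' \<rho> (Suc t) H t' H'" "Suc t \<notin> R"
  shows "aligned T R R' \<rho> t (H @ [{}]) t' H'"
proof -
  have len: "length H = T - Suc t" and t: "Suc t \<le> T" and H: "H \<in> histories T (Suc t)"
    using assms(1) by (auto simp: aligned_def histories_def)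
  have nth: "(H @ [{}]) ! (T - s) = (if s = Suc t then {} else H ! (T - s))"
    if "t < s" "s \<le> T" for s
    using that len t by (auto simp: nth_append)
  have "t < r \<longleftrightarrow> Suc t < r" if "r \<in> R" for r using assms(2) that by (cases "r = Suc t") auto
  then show ?thesis
    using assms t nth histories_snoc[OF H t, of "{}"] live_bounds by (auto simp: aligned_def)
qed

text \<open>Neither game has passed its pending live round, hence neither has passed the counterpart
  of the other's. This gives \<open>\<rho> t \<le> t'\<close> and
  \<open>t' \<le> \<rho> t\<close>.\<close>

lemma aligned_next:
  assumes "aligned T R R' \<rho> t H t' H'" "t \<in> R" "t' \<in> R'"
  shows "\<rho> t = t'"
proof -
  have "\<not> t' < \<rho> t" using assms by (auto simp: aligned_def)
  moreover have "\<not> t < \<rho>' t'"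
    using assms \<rho>'_live[OF assms(3)] \<rho>_\<rho>'[OF assms(3)] by (auto simp: aligned_def)
  then have "\<rho> (\<rho>' t') \<le> \<rho> t"
    using strict_mono_on_leD[OF \<rho>_mono \<rho>'_live[OF assms(3)] assms(2)] by simp
  ultimately show ?thesis using \<rho>_\<rho>'[OF assms(3)] by simp
qed

lemma aligned_live:
  assumes "aligned T R R' \<rho> (Suc t) H (Suc t') H'" "Suc t \<in> R" "\<rho> (Suc t) = Suc t'"
    and "h \<inter> bought H = {}"
  shows "aligned T R R' \<rho> t (H @ [h]) t' (H' @ [h])"
proof -
  have len: "length H = T - Suc t" "length H' = T - Suc t'" and t: "Suc t \<le> T" "Suc t' \<le> T"
    and H: "H \<in> histories T (Suc t)" "H' \<in> histories T (Suc t')"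
    using assms(1) by (auto simp: aligned_def histories_def)
  have nth: "(H @ [h]) ! (T - s) = (if s = Suc t then h else H ! (T - s))"
    if "t < s" "s \<le> T" for s
    using that len t by (auto simp: nth_append)
  have nth': "(H' @ [h]) ! (T - s) = (if s = Suc t' then h else H' ! (T - s))"
    if "t' < s" "s \<le> T" for s
    using that len t by (auto simp: nth_append)
  have eq: "\<rho> r = Suc t' \<longleftrightarrow> r = Suc t" if "r \<in> R" for r
    using assms(2,3) that \<rho>'_\<rho> by metis
  have lt: "t < r \<longleftrightarrow> t' < \<rho> r" if "r \<in> R" for r
  proof (cases "r = Suc t")
    case False
    then have "\<rho> r \<noteq> Suc t'" using eq[OF that] by simp
    moreover have "Suc t < r \<longleftrightarrow> Suc t' < \<rho> r" using assms(1) that by (simp add: aligned_def)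
    ultimately show ?thesis using False by linarith
  qed (use assms(3) in simp)
  have "(H @ [h]) ! (T - r) = (H' @ [h]) ! (T - \<rho> r)" if "r \<in> R" "t < r" for r
  proof (cases "r = Suc t")
    case True
    then show ?thesis using nth[of "Suc t"] nth'[of "Suc t'"] t assms(3) by simp
  next
    case False
    then have "Suc t < r" "\<rho> r \<noteq> Suc t'" using that eq by auto
    then show ?thesis
      using nth[of r] nth'[of "\<rho> r"] lt[of r] live_bounds[of r] live'_bounds[OF \<rho>_live, of r] that
        assms(1) by (auto simp: aligned_def)
  qed
  moreover have "(H @ [h]) ! (T - s) = {}" if "s \<in> {t<..T} - R" for s
    using that assms(1,2) nth[of s] by (cases "s = Suc t") (auto simp: aligned_def)
  moreover have "(H' @ [h]) ! (T - s) = {}" if "s \<in> {t'<..T} - R'" for s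
    using that assms \<rho>_live[OF assms(2)] nth'[of s] by (cases "s = Suc t'") (auto simp: aligned_def)
  moreover have "H @ [h] \<in> histories T t" "H' @ [h] \<in> histories T t'"
    using histories_snoc[OF H(1) t(1)] histories_snoc[OF H(2) t(2)] assms(4) aligned_bought[OF assms(1)]
    by simp_all
  ultimately show ?thesis using lt t by (simp add: aligned_def)
qed

text \<open>Given \<open>t\<close>, alignment determines every entry of \<open>H\<close> from
  \<open>H'\<close>. A strategy can therefore be copied by reading the history of the other game off
  the observed one.\<close>

lemma retime_eq_of_aligned:
  assumes "aligned T R R' \<rho> t H t' H'"
  shows "retime T R \<rho> t H' = H"
proof (rule nth_equalityI)
  have len: "length H = T - t" using assms by (auto simp: aligned_def histories_def)
  then show "length (retime T R \<rho> t H') = length H" by (simp add: retime_def)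
  fix k assume "k < length (retime T R \<rho> t H')"
  then have k: "k < T - t" by (simp add: retime_def)
  define s where "s = T - k"
  have s: "s \<in> {t<..T}" "k = T - s" using k by (auto simp: s_def)
  then have "H ! (T - s) = (if s \<in> R then H' ! (T - \<rho> s) else {})"
    using assms by (auto simp: aligned_def)
  then show "retime T R \<rho> t H' ! k = H ! k" using k s by (simp add: retime_def)
qed

text \<open>The order condition ensures that every entry consulted is already present in
  \<open>H'\<close>; injectivity of \<open>\<rho>\<close> keeps the sets of different rounds
  disjoint.\<close>

lemma aligned_retime:
  assumes "t \<le> T" "t' \<le> T" "H' \<in> histories T t'" "\<And>r. r \<in> R \<Longrightarrow> t < r \<longleftrightarrow> t' < \<rho> r"
    and "\<And>s. s \<in> {t'<..T} - R' \<Longrightarrow> H' ! (T - s) = {}"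
  shows "aligned T R R' \<rho> t (retime T R \<rho> t H') t' H'"
proof -
  let ?H = "retime T R \<rho> t H'"
  have nth: "?H ! (T - s) = (if s \<in> R then H' ! (T - \<rho> s) else {})" if "t < s" "s \<le> T" for s
    using that by (simp add: retime_def diff_less_mono2)
  have disj: "H' ! k \<inter> H' ! l = {}" if "k < T - t'" "l < T - t'" "k \<noteq> l" for k l
  proof -
    have "H' ! max k l \<inter> H' ! min k l = {}"
      using assms(3) that by (auto simp: histories_def simp del: disjoint_iff)
    then show ?thesis by (cases "k \<le> l") (simp_all add: Int_commute)
  qed
  have "?H ! k \<inter> ?H ! l = {}" if "k < T - t" "l < k" for k l
  proof -
    let ?r = "T - k" and ?s = "T - l"
    have rs: "t < ?r" "?r \<le> T" "t < ?s" "?s \<le> T" "T - ?r = k" "T - ?s = l" "?r \<noteq> ?s" using that by auto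
    show ?thesis
    proof (cases "?r \<in> R \<and> ?s \<in> R")
      case True
      then have "\<rho> ?r \<noteq> \<rho> ?s" using \<rho>'_\<rho> rs(7) by metis
      moreover have "t' < \<rho> ?r" "t' < \<rho> ?s" using True assms(4) rs by auto
      moreover have "\<rho> ?r \<le> T" "\<rho> ?s \<le> T" using True \<rho>_live live'_bounds by auto
      ultimately have "H' ! (T - \<rho> ?r) \<inter> H' ! (T - \<rho> ?s) = {}" by (intro disj) auto
      then show ?thesis using nth[of ?r] nth[of ?s] rs True by simp
    next
      case False
      then show ?thesis using nth[of ?r] nth[of ?s] rs by auto
    qed
  qed
  moreover have "length ?H = T - t" by (simp add: retime_def)
  ultimately have "?H \<in> histories T t" by (simp add: histories_def)
  then show ?thesis using assms nth live_bounds by (auto simp: aligned_def)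
qed

lemma aligned_finished:
  assumes "aligned T R R' \<rho> 0 H t' H'"
  shows "t' \<notin> R'"
proof
  assume "t' \<in> R'"
  then have "\<rho>' t' \<in> R" "0 < \<rho>' t'" "\<rho> (\<rho>' t') = t'" using \<rho>'_live live_bounds \<rho>_\<rho>' by force+
  then show False using assms by (auto simp: aligned_def)
qed

text \<open>The asynchronous step: unless both games are over, one of them stands at an idle round
  and may move alone, or both stand at live rounds, which then correspond. Every move lowers
  \<open>t + t'\<close>, the measure of the inductions that follow.\<close>

lemma aligned_cases [consumes 1, case_names finished idle idle' live]:
  assumes "aligned T R R' \<rho> t H t' H'"
  obtains "t = 0" "t' = 0"
    | s where "t = Suc s" "Suc s \<in> {1..T} - R" "aligned T R R' \<rho> s (H @ [{}]) t' H'"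
    | s' where "t' = Suc s'" "Suc s' \<in> {1..T} - R'" "aligned T R R' \<rho> t H s' (H' @ [{}])"
    | s s' where "t = Suc s" "t' = Suc s'" "Suc s \<in> R" "Suc s' \<in> R'" "\<rho> (Suc s) = Suc s'"
        "\<And>h. h \<inter> bought H = {} \<Longrightarrow> aligned T R R' \<rho> s (H @ [h]) s' (H' @ [h])"
proof -
  interpret S: retiming T g p' p R' R \<rho>' \<rho> by (rule swap)
  have le: "t \<le> T" "t' \<le> T" using assms by (auto simp: aligned_def)
  consider "t \<notin> R" "t > 0" | "t' \<notin> R'" "t' > 0" | "t \<in> R" "t' \<in> R'" | "t = 0" "t' = 0"
    using aligned_finished S.aligned_finished assms aligned_swap[OF assms] live_bounds live'_bounds
    by (metis gr0I)
  then show thesis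
  proof cases
    case 1
    then obtain s where "t = Suc s" by (cases t) auto
    then show thesis using that(2)[of s] 1 le aligned_skip assms by auto
  next
    case 2
    then obtain s where s: "t' = Suc s" by (cases t') auto
    have "aligned T R R' \<rho> t H s (H' @ [{}])"
      using S.aligned_swap[OF S.aligned_skip[of s H' t H]] aligned_swap[OF assms] 2 s by simp
    then show thesis using that(3)[of s] 2 s le by auto
  next
    case 3
    then obtain s s' where s: "t = Suc s" "t' = Suc s'"
      using live_bounds live'_bounds by (metis Suc_le_D One_nat_def)
    show thesis
    proof (rule that(4)[OF s])
      show "Suc s \<in> R" "Suc s' \<in> R'" "\<rho> (Suc s) = Suc s'"
        using 3 aligned_next[OF assms] s by auto
      then show "aligned T R R' \<rho> s (H @ [h]) s' (H' @ [h])" if "h \<inter> bought H = {}" for h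
        using aligned_live assms s that by blast
    qed
  next
    case 4
    then show thesis by (rule that(1))
  qed
qed

text \<open>At corresponding live rounds the price and the set of earlier buyers coincide, hence so
  does the utility. The component of the profile that belongs to \<open>i\<close> never enters, so
  agreement is asked of the others and of the two plans only.\<close>

lemma continuation_aligned:
  assumes "aligned T R R' \<rho> t H t' H'" "i \<notin> bought H" "agree T R R' \<rho> \<delta> \<delta>' x i"
    and "\<And>j. j \<noteq> i \<Longrightarrow> agree T R R' \<rho> (\<sigma> j) (\<sigma>' j) (w j) j"
  shows "continuation g p \<sigma> \<delta> i x t w H = continuation g p' \<sigma>' \<delta>' i x t' w H'"
  using assms(1,2)
proof (induction "t + t'" arbitrary: t H t' H' rule: less_induct)
  case less
  have al: "aligned T R R' \<rho> t H t' H'" by fact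
  have bt: "bought H = bought H'" by (rule aligned_bought[OF al])
  from al show ?case
  proof (cases rule: aligned_cases)
    case finished
    then show ?thesis by simp
  next
    case (idle s)
    have "\<not> \<sigma> j t (w j) H" if "j \<noteq> i" "j \<notin> bought H" for j
      using agreeD(2)[OF assms(4)[OF that(1)] al that(2)] idle(1,2) by simp
    then have P: "purchasers \<sigma> t w H - {i} = {}" by (auto simp: purchasers_def)
    have "\<not> \<delta> t x H" using agreeD(2)[OF assms(3) al less.prems(2)] idle(1,2) by simp
    then have "continuation g p \<sigma> \<delta> i x t w H = continuation g p \<sigma> \<delta> i x s w (H @ [{}])"
      using P by (simp only: idle(1) continuation.simps if_False)
    then show ?thesis using less.hyps[of s t' "H @ [{}]" H'] idle less.prems by simp
  next
    case (idle' s')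
    have "\<not> \<sigma>' j t' (w j) H'" if "j \<noteq> i" "j \<notin> bought H" for j
      using agreeD(3)[OF assms(4)[OF that(1)] al that(2)] idle'(1,2) by simp
    then have P: "purchasers \<sigma>' t' w H' - {i} = {}" by (auto simp: purchasers_def bt)
    have "\<not> \<delta>' t' x H'" using agreeD(3)[OF assms(3) al less.prems(2)] idle'(1,2) by simp
    then have "continuation g p' \<sigma>' \<delta>' i x t' w H' = continuation g p' \<sigma>' \<delta>' i x s' w (H' @ [{}])"
      using P by (simp only: idle'(1) continuation.simps if_False)
    then show ?thesis using less.hyps[of t s' H "H' @ [{}]"] idle' less.prems by simp
  next
    case (live s s')
    have "\<sigma> j t (w j) H = \<sigma>' j t' (w j) H'" if "j \<noteq> i" "j \<notin> bought H" for j
      using agreeD(1)[OF assms(4)[OF that(1)] al that(2)] live by simp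
    then have P: "purchasers \<sigma> t w H - {i} = purchasers \<sigma>' t' w H' - {i}"
      by (auto simp: purchasers_def bt)
    have "\<delta> t x H = \<delta>' t' x H'" using agreeD(1)[OF assms(3) al less.prems(2)] live by simp
    moreover have "utility g p i x t H = utility g p' i x t' H'"
      using price[OF live(3)] live by (simp add: utility_def bt)
    moreover have "continuation g p \<sigma> \<delta> i x s w (H @ [purchasers \<sigma> t w H - {i}]) =
      continuation g p' \<sigma>' \<delta>' i x s' w (H' @ [purchasers \<sigma> t w H - {i}])"
      using less.prems live(1,2)
      by (intro less.hyps live(6)) (auto simp: purchasers_def)
    ultimately show ?thesis using live(1,2) P by simp
  qed
qed

lemma play_aligned:
  assumes "aligned T R R' \<rho> t H t' H'" "\<And>j. agree T R R' \<rho> (\<sigma> j) (\<sigma>' j) (v j) j"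
  shows "aligned T R R' \<rho> 0 (play \<sigma> t v H) 0 (play \<sigma>' t' v H')"
  using assms(1)
proof (induction "t + t'" arbitrary: t H t' H' rule: less_induct)
  case less
  have al: "aligned T R R' \<rho> t H t' H'" by fact
  have bt: "bought H = bought H'" by (rule aligned_bought[OF al])
  from al show ?case
  proof (cases rule: aligned_cases)
    case finished
    then show ?thesis using al by simp
  next
    case (idle s)
    have "purchasers \<sigma> t v H = {}"
      using agreeD(2)[OF assms(2) al] idle(1,2) by (auto simp: purchasers_def)
    then show ?thesis using less.hyps[of s t' "H @ [{}]" H'] idle by auto
  next
    case (idle' s')
    have "purchasers \<sigma>' t' v H' = {}"
      using agreeD(3)[OF assms(2) al] idle'(1,2) by (auto simp: purchasers_def bt)
    then show ?thesis using less.hyps[of t s' H "H' @ [{}]"] idle' by auto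
  next
    case (live s s')
    have "\<sigma> j t (v j) H = \<sigma>' j t' (v j) H'" if "j \<notin> bought H" for j
      using agreeD(1)[OF assms(2) al that] live by simp
    then have P: "purchasers \<sigma> t v H = purchasers \<sigma>' t' v H'"
      by (auto simp: purchasers_def bt)
    have "aligned T R R' \<rho> 0 (play \<sigma> s v (H @ [purchasers \<sigma> t v H])) 0
      (play \<sigma>' s' v (H' @ [purchasers \<sigma> t v H]))"
      using live(1,2) by (intro less.hyps live(6)) (auto simp: purchasers_def)
    then show ?thesis using live(1,2) P by simp
  qed
qed

lemma agree_swap:
  assumes "agree T R R' \<rho> a a' y i"
  shows "agree T R' R \<rho>' a' a y i"
  unfolding agree_def
proof (intro allI impI)
  fix t H t' H' assume al: "aligned T R' R \<rho>' t H t' H' \<and> i \<notin> bought H"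
  interpret S: retiming T g p' p R' R \<rho>' \<rho> by (rule swap)
  show "(t \<in> R' \<and> t' = \<rho>' t \<longrightarrow> a' t y H = a t' y H') \<and>
        (t \<in> {1..T} - R' \<longrightarrow> \<not> a' t y H) \<and> (t' \<in> {1..T} - R \<longrightarrow> \<not> a t' y H')"
    using agreeD[OF assms S.aligned_swap[of t H t' H']] S.aligned_bought[of t H t' H'] al \<rho>'_live \<rho>_\<rho>'
    by metis
qed

end

section \<open>Transferring equilibria\<close>

lemma uniform_measure_full:
  assumes "prob_space M" "A \<in> sets M" "AE w in M. w \<in> A"
  shows "uniform_measure M A = M"
proof -
  interpret prob_space M by fact
  have A: "emeasure M A = 1" using assms by (simp add: emeasure_eq_1_AE)
  show ?thesis
  proof (rule measure_eqI)
    fix B assume "B \<in> sets (uniform_measure M A)"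
    then have B: "B \<in> sets M" by simp
    have "emeasure M (A \<inter> B) = emeasure M B"
      by (rule emeasure_eq_AE) (use assms B in auto)
    then show "emeasure (uniform_measure M A) B = emeasure M B"
      using assms(2) B A by (simp add: divide_ennreal_def)
  qed simp
qed

definition clean :: "nat \<Rightarrow> nat set \<Rightarrow> 'b history \<Rightarrow> bool" where
  "clean T R H \<longleftrightarrow> (\<forall>k < length H. T - k \<notin> R \<longrightarrow> H ! k = {})"

lemma clean_appendD: "clean T R (H @ G) \<Longrightarrow> clean T R H"
  unfolding clean_def by (metis length_append nth_append trans_less_add1)

context retiming
begin

text \<open>The profiles agree only for valuations in \<open>{0..1}\<close>; an admissible belief is
  concentrated there, so the integrands are equal almost everywhere.\<close>

lemma expected_payoff_aligned:
  assumes "sets F = sets borel" "measurable_profile \<sigma>" "measurable_profile \<sigma>'" "admissible F i M"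
    and "\<And>j y. y \<in> {0..1} \<Longrightarrow> agree T R R' \<rho> (\<sigma> j) (\<sigma>' j) y j"
    and "aligned T R R' \<rho> t H t' H'" "i \<notin> bought H" "agree T R R' \<rho> \<delta> \<delta>' x i"
  shows "expected_payoff g p \<sigma> M i x t H \<delta> = expected_payoff g p' \<sigma>' M i x t' H' \<delta>'"
proof -
  have "i \<notin> bought H'" using assms(7) aligned_bought[OF assms(6)] by simp
  moreover have "(\<integral>w. continuation g p \<sigma> \<delta> i x t w H \<partial>M) = (\<integral>w. continuation g p' \<sigma>' \<delta>' i x t' w H' \<partial>M)"
  proof (rule integral_cong_AE)
    have "AE w in M. \<forall>j \<in> UNIV - {i}. w j \<in> {0..1}" using assms(4) by (simp add: admissible_def)
    then show "AE w in M. continuation g p \<sigma> \<delta> i x t w H = continuation g p' \<sigma>' \<delta>' i x t' w H'"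
    proof eventually_elim
      case (elim w)
      then show ?case by (intro continuation_aligned[OF assms(6-8)] assms(5)) auto
    qed
  qed (intro continuation_measurable[OF assms(1) _ assms(4)] assms(2,3))+
  ultimately show ?thesis using assms(7) by (simp add: expected_payoff_eq_continuation)
qed

lemma agree_transfer:
  assumes "\<And>t x H. t \<notin> R' \<Longrightarrow> \<not> \<delta>' t x H"
  shows "agree T R R' \<rho> (\<lambda>t x H. t \<in> R \<and> \<delta>' (\<rho> t) x (retime T R' \<rho>' (\<rho> t) H)) \<delta>' x i"
proof -
  interpret S: retiming T g p' p R' R \<rho>' \<rho> by (rule swap)
  have "retime T R' \<rho>' t' H = H'" if "aligned T R R' \<rho> t H t' H'" for t H t' H'
    by (rule S.retime_eq_of_aligned[OF aligned_swap[OF that]])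
  then show ?thesis unfolding agree_def by (metis (no_types, lifting) DiffD2 assms)
qed

text \<open>Postponement costs nothing and makes the plan silent at idle rounds, so that
  \<open>agree_transfer\<close> can copy it. Counting from \<open>length H'\<close> leaves no
  purchase pending at the start, whence the decision at the present live round is unchanged and a
  plan that waits is copied to one that waits.\<close>

lemma transfer_deviation:
  assumes "sets F = sets borel" "measurable_profile \<sigma>" "measurable_profile \<sigma>'" "admissible F i M"
    and "\<And>j y. y \<in> {0..1} \<Longrightarrow> agree T R R' \<rho> (\<sigma> j) (\<sigma>' j) y j"
    and "aligned T R R' \<rho> t H t' H'" "i \<notin> bought H" "x \<le> 1"
  obtains \<delta> where "expected_payoff g p' \<sigma>' M i x t' H' \<delta>' \<le> expected_payoff g p \<sigma> M i x t H \<delta>"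
    and "t \<in> R \<Longrightarrow> t' = \<rho> t \<Longrightarrow> \<delta> t x H \<longleftrightarrow> \<delta>' t' x H'"
proof -
  let ?D = "postpone T R' (length H') \<delta>'"
  let ?\<delta> = "\<lambda>t x H. t \<in> R \<and> ?D (\<rho> t) x (retime T R' \<rho>' (\<rho> t) H)"
  have nb: "i \<notin> bought H'" using assms(7) aligned_bought[OF assms(6)] by simp
  have ag: "agree T R R' \<rho> ?\<delta> ?D x i" by (rule agree_transfer) (simp add: postpone_def)
  have "expected_payoff g p' \<sigma>' M i x t' H' \<delta>' \<le> expected_payoff g p' \<sigma>' M i x t' H' ?D"
    using assms(6) nb
    by (intro expected_payoff_mono[OF assms(1,3,4)] continuation_le_postpone[OF idle' assms(8)])
      (auto simp: aligned_def histories_def)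
  also have "\<dots> = expected_payoff g p \<sigma> M i x t H ?\<delta>"
    by (rule expected_payoff_aligned[OF assms(1-7) ag, symmetric])
  finally show thesis
  proof (rule that)
    assume "t \<in> R" "t' = \<rho> t"
    then show "?\<delta> t x H \<longleftrightarrow> \<delta>' t' x H'"
      using agreeD(1)[OF ag assms(6,7)] \<rho>_live by (auto simp: postpone_def)
  qed
qed

lemma waiting_value_le_aligned:
  assumes "sets F = sets borel" "measurable_profile \<sigma>" "measurable_profile \<sigma>'" "admissible F i M"
    and "\<And>j y. y \<in> {0..1} \<Longrightarrow> agree T R R' \<rho> (\<sigma> j) (\<sigma>' j) y j"
    and "aligned T R R' \<rho> t H t' H'" "i \<notin> bought H" "x \<le> 1" "t \<in> R" "t' = \<rho> t"
  shows "waiting_value g p' \<sigma>' M i x t' H' \<le> waiting_value g p \<sigma> M i x t H"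
  unfolding waiting_value_def[of g p' \<sigma>']
proof (rule cSUP_least)
  show "{\<delta>. \<not> \<delta> t' x H'} \<noteq> {}" by (auto intro!: exI[of _ "\<lambda>_ _ _. False"])
  fix \<delta>' assume "\<delta>' \<in> {\<delta>. \<not> \<delta> t' x H'}"
  then have "\<not> \<delta>' t' x H'" by simp
  obtain \<delta> where \<delta>: "expected_payoff g p' \<sigma>' M i x t' H' \<delta>' \<le> expected_payoff g p \<sigma> M i x t H \<delta>"
    and "\<delta> t x H \<longleftrightarrow> \<delta>' t' x H'"
    using transfer_deviation[OF assms(1-8), of \<delta>'] assms(9,10) by metis
  then have "\<not> \<delta> t x H" using \<open>\<not> \<delta>' t' x H'\<close> by simp
  then have "expected_payoff g p \<sigma> M i x t H \<delta> \<le> waiting_value g p \<sigma> M i x t H"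
    by (rule expected_payoff_le_waiting_value[OF assms(1,2,4,7)])
  with \<delta> show "expected_payoff g p' \<sigma>' M i x t' H' \<delta>' \<le> waiting_value g p \<sigma> M i x t H" by simp
qed

lemma waiting_value_aligned:
  assumes "sets F = sets borel" "measurable_profile \<sigma>" "measurable_profile \<sigma>'" "admissible F i M"
    and "\<And>j y. y \<in> {0..1} \<Longrightarrow> agree T R R' \<rho> (\<sigma> j) (\<sigma>' j) y j"
    and "aligned T R R' \<rho> t H t' H'" "i \<notin> bought H" "x \<le> 1" "t \<in> R" "t' = \<rho> t"
  shows "waiting_value g p' \<sigma>' M i x t' H' = waiting_value g p \<sigma> M i x t H"
proof (rule antisym)
  show "waiting_value g p' \<sigma>' M i x t' H' \<le> waiting_value g p \<sigma> M i x t H"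
    by (rule waiting_value_le_aligned[OF assms])
  interpret S: retiming T g p' p R' R \<rho>' \<rho> by (rule swap)
  show "waiting_value g p \<sigma> M i x t H \<le> waiting_value g p' \<sigma>' M i x t' H'"
    using assms aligned_bought[OF assms(6)] \<rho>_live \<rho>'_\<rho>
    by (intro S.waiting_value_le_aligned[OF assms(1,3,2,4) agree_swap aligned_swap]) auto
qed

lemma aligned_clean:
  assumes "aligned T R R' \<rho> t H t' H'"
  shows "clean T R' H'"
  unfolding clean_def
proof (intro allI impI)
  fix k assume k: "k < length H'" "T - k \<notin> R'"
  define s where "s = T - k"
  have "s \<in> {t'<..T} - R'" "k = T - s" using k assms by (auto simp: s_def aligned_def histories_def)
  then show "H' ! k = {}" using assms by (simp add: aligned_def)
qed

lemma aligned_retime_clean: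
  assumes "t \<le> T" "t' \<le> T" "H' \<in> histories T t'" "clean T R' H'"
    and "\<And>r. r \<in> R \<Longrightarrow> t < r \<longleftrightarrow> t' < \<rho> r"
  shows "aligned T R R' \<rho> t (retime T R \<rho> t H') t' H'"
proof (rule aligned_retime)
  fix s assume "s \<in> {t'<..T} - R'"
  moreover from this have "T - s < length H'" "T - (T - s) = s" using assms(3) by (auto simp: histories_def)
  ultimately show "H' ! (T - s) = {}" using assms(4) by (simp add: clean_def)
qed (use assms in auto)

text \<open>
  A strategy after clean histories is copied from the first game. After a purchase at an idle round,
  which happens only off the equilibrium path, the given profile \<open>\<sigma>0\<close> takes over: Bayes' rule puts
  no constraint on the beliefs there.
\<close>

lemma transfer_equilibrium:
  assumes borel: "sets F = sets borel" and eq: "equilibrium T g F p \<sigma>"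
    and \<sigma>0: "measurable_profile \<sigma>0"
    and off: "\<And>i t' H'. t' \<le> T \<Longrightarrow> H' \<in> histories T t' \<Longrightarrow> \<not> clean T R' H' \<Longrightarrow>
      rational_at g F p' \<sigma>0 \<mu>0 i t' H'"
  obtains \<sigma>' where "equilibrium T g F p' \<sigma>'"
    and "\<And>v. (\<And>i. v i \<in> {0..1}) \<Longrightarrow> aligned T R R' \<rho> 0 (play \<sigma> T v []) 0 (play \<sigma>' T v [])"
proof -
  interpret S: retiming T g p' p R' R \<rho>' \<rho> by (rule swap)
  obtain \<mu> where meas: "measurable_profile \<sigma>" and prior: "\<And>i. \<mu> i [] = PiM (UNIV - {i}) (\<lambda>_. F)"
    and rat: "\<And>i t H. t \<le> T \<Longrightarrow> H \<in> histories T t \<Longrightarrow> rational_at g F p \<sigma> \<mu> i t H"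
    using eq unfolding equilibrium_iff by blast
  have adm: "admissible F i (\<mu> i H)" if "t \<le> T" "H \<in> histories T t" for i t H
    using rat[OF that] by (simp add: rational_at_def)
  have bayes: "\<mu> i (H @ [h]) =
             uniform_measure (\<mu> i H) {w \<in> space (\<mu> i H). purchasers \<sigma> t w H - {i} = h}"
    if "1 \<le> t" "t \<le> T" "H \<in> histories T t" "i \<notin> bought H" "h \<inter> bought H = {}" "i \<notin> h"
       "measure (\<mu> i H) {w \<in> space (\<mu> i H). purchasers \<sigma> t w H - {i} = h} > 0" for i t H h
    using rat[OF that(2,3), of i] that unfolding rational_at_def by blast
  have best: "expected_payoff g p \<sigma> (\<mu> i H) i x t H \<delta> \<le> expected_payoff g p \<sigma> (\<mu> i H) i x t H (\<sigma> i)"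
    and choice: "\<sigma> i t x H \<longleftrightarrow> utility g p i x t H \<ge> waiting_value g p \<sigma> (\<mu> i H) i x t H"
    if "1 \<le> t" "t \<le> T" "H \<in> histories T t" "i \<notin> bought H" "x \<in> {0..1}" for i t H x \<delta>
    using rat[OF that(2,3), of i] that unfolding rational_at_def by blast+
  have silent: "\<not> \<sigma> i t x H"
    if "t \<in> {1..T} - R" "H \<in> histories T t" "i \<notin> bought H" "x \<in> {0..1}" for i t H x
    using idle_waiting_value_gt[OF borel meas adm idle that(1,3), of t H x] choice[of t H i x] that by auto

  \<comment> \<open>Histories of the first game that differ in the number of idle rounds passed may
    be aligned with the same \<open>H'\<close>. At those rounds the others are almost surely silent,
    so Bayes' rule conditions on an almost sure event.\<close>
  have belief_skip: "\<mu> i G = \<mu> i H"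
    if "aligned T R R' \<rho> (t + n) H t' H'" "aligned T R R' \<rho> t G t' H'" "i \<notin> bought H" for i n t H G t' H'
    using that
  proof (induction n arbitrary: H)
    case 0
    then show ?case using retime_eq_of_aligned[of t G t' H'] retime_eq_of_aligned[of t H t' H'] by simp
  next
    case (Suc n)
    let ?M = "\<mu> i H" and ?A = "{w \<in> space (\<mu> i H). purchasers \<sigma> (Suc (t + n)) w H - {i} = {}}"
    have al: "aligned T R R' \<rho> (Suc (t + n)) H t' H'" using Suc.prems by simp
    then have t: "Suc (t + n) \<le> T" and H: "H \<in> histories T (Suc (t + n))" by (auto simp: aligned_def)
    have notR: "Suc (t + n) \<notin> R"
      using al Suc.prems(2) by (auto simp: aligned_def)
    have M: "admissible F i ?M" by (rule adm[OF t H])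
    have A: "?A \<in> sets ?M" by (rule purchasers_event[OF borel meas M])
    have AE: "AE w in ?M. w \<in> ?A"
    proof -
      have "AE w in ?M. \<forall>j \<in> UNIV - {i}. w j \<in> {0..1}" using M by (simp add: admissible_def)
      then show ?thesis
      proof (rule AE_mp, intro AE_I2 impI)
        fix w assume "w \<in> space ?M" "\<forall>j \<in> UNIV - {i}. w j \<in> {0..1}"
        then show "w \<in> ?A"
          using silent[of "Suc (t + n)" H] t H notR by (auto simp: purchasers_def)
      qed
    qed
    have prob: "prob_space ?M" using M by (simp add: admissible_def)
    then have "measure ?M ?A = 1" using AE A by (simp add: prob_space.prob_eq_1)
    then have "\<mu> i (H @ [{}]) = uniform_measure ?M ?A"
      using t H Suc.prems(3) by (intro bayes) auto
    also have "\<dots> = ?M" by (rule uniform_measure_full[OF prob A AE])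
    finally show ?case
      using Suc.IH[OF aligned_skip[OF al notR] Suc.prems(2)] Suc.prems(3) by simp
  qed
  have belief_unique: "\<mu> i G = \<mu> i H"
    if "aligned T R R' \<rho> s G t' H'" "aligned T R R' \<rho> t H t' H'" "i \<notin> bought H" for i s t H G t' H'
  proof (cases "s \<le> t")
    case True
    then show ?thesis using belief_skip[of s "t - s" H t' H' G i] that by simp
  next
    case False
    have "i \<notin> bought G" using that aligned_bought by blast
    then show ?thesis using False belief_skip[of t "s - t" G t' H' H i] that by simp
  qed

  \<comment> \<open>The position of the first game once idle rounds are skipped: its next live round
    when the second game is before \<open>t'\<close>, or 0 if none is left.\<close>
  define nxt where "nxt t' = Max (insert 0 {r \<in> R. \<rho> r \<le> t'})" for t'
  have "finite R" using idle by (auto simp: idle_outside_def intro: finite_subset)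
  then have fin: "finite (insert 0 {r \<in> R. \<rho> r \<le> t'})" for t' by simp
  have nxt_le: "nxt t' \<le> T" for t'
    unfolding nxt_def using fin live_bounds by (subst Max_le_iff) auto
  have nxt_iff: "nxt t' < r \<longleftrightarrow> t' < \<rho> r" if r: "r \<in> R" for t' r
  proof
    assume "nxt t' < r"
    then show "t' < \<rho> r" using Max_ge[OF fin, of r t'] r unfolding nxt_def by (force simp: not_less)
  next
    assume "t' < \<rho> r"
    then have "s < r" if "s \<in> R" "\<rho> s \<le> t'" for s
      using strict_mono_on_less[OF \<rho>_mono that(1) r] that(2) by simp
    then show "nxt t' < r" unfolding nxt_def using fin live_bounds[OF r] by (subst Max_less_iff) auto
  qed

  \<comment> \<open>The conjunct \<open>t' \<in> R'\<close> silences idle rounds after clean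
    histories for all valuations, also those outside \<open>{0..1}\<close>, so that Bayes' rule is
    trivial there.\<close>
  define \<sigma>' where "\<sigma>' j t' x H' \<longleftrightarrow>
    (if clean T R' H' then t' \<in> R' \<and> \<sigma> j (\<rho>' t') x (retime T R \<rho> (\<rho>' t') H') else \<sigma>0 j t' x H')"
    for j t' x H'
  \<comment> \<open>Beliefs are needed at idle rounds and after the last round too, where
    \<open>\<rho>'\<close> has no meaning; hence \<open>nxt\<close>. The round is recovered from the
    length of the history.\<close>
  define \<mu>' where "\<mu>' i H' =
    (if clean T R' H' then \<mu> i (retime T R \<rho> (nxt (T - length H')) H') else \<mu>0 i H')"
    for i H'

  have \<mu>'_eq: "\<mu>' i H' = \<mu> i H" if al: "aligned T R R' \<rho> t H t' H'" "i \<notin> bought H" for i t H t' H'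
  proof -
    have t': "t' \<le> T" "H' \<in> histories T t'" "T - length H' = t'"
      using al by (auto simp: aligned_def histories_def)
    have "aligned T R R' \<rho> (nxt t') (retime T R \<rho> (nxt t') H') t' H'"
      by (rule aligned_retime_clean[OF nxt_le t'(1,2) aligned_clean[OF al(1)] nxt_iff])
    then show ?thesis
      using belief_unique[OF _ al] aligned_clean[OF al(1)] t'(3) by (simp add: \<mu>'_def)
  qed
  have agr: "agree T R R' \<rho> (\<sigma> j) (\<sigma>' j) y j" if y: "y \<in> {0..1}" for j y
    unfolding agree_def
  proof (intro allI impI conjI)
    fix t H t' H' assume al: "aligned T R R' \<rho> t H t' H' \<and> j \<notin> bought H"
    then have cl: "clean T R' H'" using aligned_clean by blast
    have "retime T R \<rho> t H' = H" using retime_eq_of_aligned al by blast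
    then show "\<sigma> j t y H = \<sigma>' j t' y H'" if "t \<in> R \<and> t' = \<rho> t"
      using cl that \<rho>_live \<rho>'_\<rho> by (auto simp: \<sigma>'_def)
    show "\<not> \<sigma> j t y H" if "t \<in> {1..T} - R"
      using silent[OF that _ _ y] al by (simp add: aligned_def)
    show "\<not> \<sigma>' j t' y H'" if "t' \<in> {1..T} - R'"
      using cl that by (simp add: \<sigma>'_def)
  qed
  have meas': "measurable_profile \<sigma>'"
    unfolding measurable_profile_def
  proof (intro allI)
    fix i t H
    show "{x. \<sigma>' i t x H} \<in> sets borel"
      using meas \<sigma>0 by (cases "clean T R' H"; cases "t \<in> R'") (simp_all add: \<sigma>'_def measurable_profile_def)
  qed

  have rat': "rational_at g F p' \<sigma>' \<mu>' i t' H'" if t': "t' \<le> T" and H': "H' \<in> histories T t'" for i t' H'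
  proof (cases "clean T R' H'")
    case False
    then have "\<not> clean T R' (H' @ G)" for G using clean_appendD by blast
    then have "rational_at g F p' \<sigma>' \<mu>' i t' H' \<longleftrightarrow> rational_at g F p' \<sigma>0 \<mu>0 i t' H'"
      by (intro rational_at_cong) (simp_all add: \<sigma>'_def \<mu>'_def)
    then show ?thesis using off[OF t' H' False] by simp
  next
    case cl: True
    define t where "t = nxt t'"
    define H where "H = retime T R \<rho> t H'"
    have al: "aligned T R R' \<rho> t H t' H'"
      unfolding t_def H_def by (rule aligned_retime_clean[OF nxt_le t' H' cl nxt_iff])
    then have t: "t \<le> T" and H: "H \<in> histories T t" by (auto simp: aligned_def)
    define M where "M = \<mu> i H"
    have M': "\<mu>' i H' = M"
      using cl histories_length[OF H'] t' by (simp add: \<mu>'_def M_def H_def t_def)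
    have M: "admissible F i M" unfolding M_def by (rule adm[OF t H])
    have bt: "bought H = bought H'" by (rule aligned_bought[OF al])
    show ?thesis
      unfolding rational_at_def M'
    proof (intro conjI impI allI ballI, goal_cases)
      case 1
      show ?case by (rule M)
    next
      case (2 h)
      show ?case
      proof (cases "t' \<in> R'")
        case False
        have P: "purchasers \<sigma>' t' w H' = {}" for w using cl False by (simp add: purchasers_def \<sigma>'_def)
        have h: "h = {}" using 2(3) by (rule contrapos_pp) (simp add: P)
        then have A: "{w \<in> space M. purchasers \<sigma>' t' w H' - {i} = h} = space M" by (simp add: P)
        obtain s' where s': "t' = Suc s'" using 2 by (cases t') auto
        have "aligned T R R' \<rho> t H s' (H' @ [{}])"
          using S.aligned_swap[OF S.aligned_skip[of s' H' t H]] aligned_swap[OF al] False s' by simp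
        then have "\<mu>' i (H' @ [h]) = M" using \<mu>'_eq 2 bt h by (simp add: M_def)
        also have "\<dots> = uniform_measure M (space M)"
          using M by (intro uniform_measure_full[symmetric]) (auto simp: admissible_def)
        finally show ?thesis using A by simp
      next
        case True
        \<comment> \<open>The decision at \<open>t'\<close> is copied from its exact counterpart
          \<open>t0\<close>. Alignment with the same \<open>H'\<close> guarantees that the belief
          there is again \<open>M\<close>.\<close>
        define t0 where "t0 = \<rho>' t'"
        define H0 where "H0 = retime T R \<rho> t0 H'"
        have t0: "t0 \<in> R" "\<rho> t0 = t'" "1 \<le> t0" "t0 \<le> T"
          using True \<rho>'_live \<rho>_\<rho>' live_bounds by (auto simp: t0_def)
        have al0: "aligned T R R' \<rho> t0 H0 t' H'"
          unfolding H0_def using strict_mono_on_less[OF \<rho>_mono t0(1)] t0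
          by (intro aligned_retime_clean[OF t0(4) t' H' cl]) auto
        have bt0: "bought H0 = bought H'" by (rule aligned_bought[OF al0])
        have M0: "\<mu> i H0 = M" unfolding M_def using belief_unique[OF al0 al] 2 bt by simp
        have P: "purchasers \<sigma>' t' w H' = purchasers \<sigma> t0 w H0" for w
          using cl True bt0 by (simp add: purchasers_def \<sigma>'_def t0_def H0_def)
        obtain s s' where s: "t0 = Suc s" "t' = Suc s'"
          using 2 t0 by (metis One_nat_def Suc_le_D)
        have "aligned T R R' \<rho> s (H0 @ [h]) s' (H' @ [h])"
          using aligned_live[of s H0 s' H' h] al0 t0 s 2 bt0 by simp
        then have "\<mu>' i (H' @ [h]) = \<mu> i (H0 @ [h])" using \<mu>'_eq 2 bt0 by simp
        also have "\<dots> = uniform_measure (\<mu> i H0) {w \<in> space (\<mu> i H0). purchasers \<sigma> t0 w H0 - {i} = h}"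
          using al0 2 bt0 t0 M0 P by (intro bayes) (auto simp: aligned_def)
        finally show ?thesis using M0 P by simp
      qed
    next
      case (3 x \<delta>')
      have nb: "i \<notin> bought H" using 3 bt by simp
      have x: "x \<in> {0..1}" "x \<le> 1" using 3 by auto
      obtain \<delta> where "expected_payoff g p' \<sigma>' M i x t' H' \<delta>' \<le> expected_payoff g p \<sigma> M i x t H \<delta>"
        using transfer_deviation[OF borel meas meas' M agr al nb x(2), of \<delta>'] by metis
      also have "\<dots> \<le> expected_payoff g p \<sigma> M i x t H (\<sigma> i)"
      \<comment> \<open>If no round is left in the first game, every plan earns 0 there.\<close>
      proof (cases "t = 0")
        case True
        then show ?thesis using nb by (simp add: expected_payoff_eq_continuation)
      next
        case False
        then show ?thesis unfolding M_def using nb x t H by (intro best) auto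
      qed
      also have "\<dots> = expected_payoff g p' \<sigma>' M i x t' H' (\<sigma>' i)"
        by (rule expected_payoff_aligned[OF borel meas meas' M agr al nb agr[OF x(1)]])
      finally show ?case .
    next
      case (4 x)
      have x: "x \<in> {0..1}" "x \<le> 1" using 4 by auto
      show ?case
      proof (cases "t' \<in> R'")
        case False
        then show ?thesis
          using idle_waiting_value_gt[OF borel meas' M idle', of t' H' x] 4 t' cl x by (auto simp: \<sigma>'_def)
      next
        case True
        define t0 where "t0 = \<rho>' t'"
        define H0 where "H0 = retime T R \<rho> t0 H'"
        have t0: "t0 \<in> R" "t' = \<rho> t0" "1 \<le> t0" "t0 \<le> T"
          using True \<rho>'_live \<rho>_\<rho>' live_bounds by (auto simp: t0_def)
        have al0: "aligned T R R' \<rho> t0 H0 t' H'"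
          unfolding H0_def using strict_mono_on_less[OF \<rho>_mono t0(1)] t0
          by (intro aligned_retime_clean[OF t0(4) t' H' cl]) auto
        have bt0: "bought H0 = bought H'" by (rule aligned_bought[OF al0])
        have nb0: "i \<notin> bought H0" using bt0 4 by simp
        have M0: "\<mu> i H0 = M" unfolding M_def using belief_unique[OF al0 al] 4 bt by simp
        have "\<sigma>' i t' x H' \<longleftrightarrow> \<sigma> i t0 x H0" using cl True by (simp add: \<sigma>'_def t0_def H0_def)
        also have "\<dots> \<longleftrightarrow> utility g p i x t0 H0 \<ge> waiting_value g p \<sigma> M i x t0 H0"
          using al0 nb0 t0 x unfolding M0[symmetric] by (intro choice) (auto simp: aligned_def)
        also have "utility g p i x t0 H0 = utility g p' i x t' H'"
          using price[OF t0(1)] t0(2) by (simp add: utility_def bt0)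
        also have "waiting_value g p \<sigma> M i x t0 H0 = waiting_value g p' \<sigma>' M i x t' H'"
          by (rule waiting_value_aligned[OF borel meas meas' M agr al0 nb0 x(2) t0(1,2), symmetric])
        finally show ?thesis .
      qed
    qed
  qed
  have "\<mu>' i [] = PiM (UNIV - {i}) (\<lambda>_. F)" for i
    using \<mu>'_eq[OF aligned_initial] prior by simp
  then have "equilibrium T g F p' \<sigma>'" unfolding equilibrium_iff using meas' rat' by blast
  then show thesis
  proof (rule that)
    show "aligned T R R' \<rho> 0 (play \<sigma> T v []) 0 (play \<sigma>' T v [])" if "\<And>i. v i \<in> {0..1}" for v
      by (rule play_aligned[OF aligned_initial agr[OF that]])
  qed
qed

end

section \<open>The optimal prices\<close>

definition undercut_free :: "nat \<Rightarrow> (nat \<Rightarrow> real) \<Rightarrow> nat set" where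
  "undercut_free T p = {t \<in> {1..T}. \<forall>s \<in> {1..<t}. p t \<le> p s}"

text \<open>The cheapest round \<open>r\<close> after \<open>d\<close> is live, so the next live
  round \<open>?q\<close> after \<open>d\<close> is \<open>r\<close> or precedes it in time. As
  \<open>?q\<close> is not undercut by \<open>r\<close>, its price is at most the minimum, which is
  below \<open>p d\<close>.\<close>

lemma idle_outside_undercut_free:
  fixes g :: "'b::finite \<Rightarrow> 'b \<Rightarrow> real"
  assumes "\<And>i j. 0 \<le> g i j"
  shows "idle_outside T g p (undercut_free T p)"
proof -
  let ?R = "undercut_free T p"
  have "reserve_price g p ?R d < p d" if d: "d \<in> {1..T} - ?R" for d
  proof -
    obtain s where s: "s \<in> {1..<d}" "p s < p d" using d by (auto simp: undercut_free_def)
    let ?m = "Min (p ` {1..<d})"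
    have fin: "finite (p ` {1..<d})" "p ` {1..<d} \<noteq> {}" using s by auto
    obtain r where r: "r \<in> {1..<d}" "p r = ?m" using Min_in[OF fin] by auto
    have min: "p r \<le> p k" if "k \<in> {1..<d}" for k using Min_le[OF fin(1), of "p k"] that r by simp
    then have rR: "r \<in> ?R \<inter> {..<d}" using r d by (auto simp: undercut_free_def)
    let ?q = "Max (?R \<inter> {..<d})"
    have q: "?q \<in> ?R \<inter> {..<d}" by (rule Max_in) (use rR in auto)
    have "r \<le> ?q" by (rule Max_ge) (use rR in auto)
    then have "r = ?q \<or> r \<in> {1..<?q}" using r(1) by auto
    moreover have "\<forall>s \<in> {1..<?q}. p ?q \<le> p s" using q unfolding undercut_free_def by blast
    ultimately have "p ?q \<le> p r" by (metis order_refl)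
    also have "\<dots> \<le> p s" by (rule min[OF s(1)])
    finally show ?thesis using s(2) rR by (auto simp: reserve_price_def)
  qed
  then show ?thesis using assms by (auto simp: idle_outside_def undercut_free_def)
qed

lemma buyers_at_of_aligned:
  assumes "aligned T R R' \<rho> 0 (play \<sigma> T v []) 0 (play \<sigma>' T v [])" "R \<subseteq> {1..T}"
  shows "t \<in> R \<Longrightarrow> buyers_at T \<sigma> v t = buyers_at T \<sigma>' v (\<rho> t)"
    and "t \<in> {1..T} - R \<Longrightarrow> buyers_at T \<sigma> v t = {}"
    and "t \<in> {1..T} - R' \<Longrightarrow> buyers_at T \<sigma>' v t = {}"
proof -
  have al: "\<forall>r \<in> R. 0 < r \<longrightarrow> play \<sigma> T v [] ! (T - r) = play \<sigma>' T v [] ! (T - \<rho> r)"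
    "\<forall>s \<in> {0<..T} - R. play \<sigma> T v [] ! (T - s) = {}"
    "\<forall>s \<in> {0<..T} - R'. play \<sigma>' T v [] ! (T - s) = {}"
    using assms(1) unfolding aligned_def by blast+
  show "t \<in> R \<Longrightarrow> buyers_at T \<sigma> v t = buyers_at T \<sigma>' v (\<rho> t)"
    using al(1) assms(2) unfolding buyers_at_def by force
  show "t \<in> {1..T} - R \<Longrightarrow> buyers_at T \<sigma> v t = {}"
    "t \<in> {1..T} - R' \<Longrightarrow> buyers_at T \<sigma>' v t = {}"
    using al(2,3) by (auto simp: buyers_at_def)
qed

lemma same_path_retimed_of_aligned:
  assumes "\<And>v. (\<And>i. v i \<in> {0..1}) \<Longrightarrow> aligned T R R' \<rho> 0 (play \<sigma> T v []) 0 (play \<sigma>' T v [])"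
    and "R \<subseteq> {1..T}" "\<rho> ` R = R'"
  shows "same_path_retimed T R \<rho> \<sigma> \<sigma>'"
  unfolding same_path_retimed_def assms(3)
  using buyers_at_of_aligned[OF assms(1,2)] by simp

text \<open>
  \<open>\<sigma>0\<close> is needed for play after a purchase at an idle round of \<open>p\<close>: such a subgame has no counterpart
  in the game with the new prices, and in general it need not have an equilibrium.
\<close>

lemma same_equilibrium_paths_nondecreasing:
  fixes g :: "'b::finite \<Rightarrow> 'b \<Rightarrow> real"
  assumes g: "\<And>i j. 0 \<le> g i j" and F: "real_distribution F" "measure F {0..1} = 1"
    and eq0: "equilibrium T g F p \<sigma>0"
  shows "\<exists>p'. nondecreasing_over_time T p' \<and> same_equilibrium_paths T g F p p'"
proof -
  interpret F: real_distribution F by (rule F(1))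
  have borel: "sets F = sets borel" by simp
  define R where "R = undercut_free T p"
  \<comment> \<open>Round \<open>T\<close> is the first in time, so these are the first
    \<open>card R\<close> rounds; \<open>\<rho>\<close> places a live round behind the live rounds
    preceding it in time, which have larger indices.\<close>
  define R' where "R' = {T - card R<..T}"
  define \<rho> where "\<rho> t = T - card {r \<in> R. t < r}" for t
  define \<rho>' where "\<rho>' = inv_into R \<rho>"
  \<comment> \<open>Large enough to deter every valuation in [0, 1] even with all weights collected,
    and at least every old price, so that the tail does not break monotonicity.\<close>
  define C where "C = 2 + (\<Sum>i\<in>UNIV. \<Sum>j\<in>UNIV. g i j) + (\<Sum>t = 1..T. \<bar>p t\<bar>)"
  define p' where "p' t = (if t \<in> R' then p (\<rho>' t) else C)" for t
  have R: "R \<subseteq> {1..T}" by (auto simp: R_def undercut_free_def)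
  then have finR: "finite R" by (rule finite_subset) simp
  have card_R: "card R \<le> T" using card_mono[OF _ R] by simp
  have R': "R' \<subseteq> {1..T}" and card_R': "card R' = card R" using card_R by (auto simp: R'_def)
  have later: "card {r \<in> R. t < r} < card R" if "t \<in> R" for t
    by (rule psubset_card_mono[OF finR]) (use that in auto)
  have \<rho>_live: "\<rho> t \<in> R'" if "t \<in> R" for t
    using later[OF that] card_R by (auto simp: \<rho>_def R'_def)
  have mono: "strict_mono_on R \<rho>"
  proof (rule strict_mono_onI)
    fix r s assume rs: "r \<in> R" "s \<in> R" "r < s"
    have "card {q \<in> R. s < q} < card {q \<in> R. r < q}"
      by (rule psubset_card_mono) (use rs finR in auto)
    then show "\<rho> r < \<rho> s" using later[OF rs(1)] card_R by (simp add: \<rho>_def)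
  qed
  have inj: "inj_on \<rho> R" by (rule strict_mono_on_imp_inj_on[OF mono])
  have img: "\<rho> ` R = R'"
  proof (rule card_subset_eq)
    show "\<rho> ` R \<subseteq> R'" using \<rho>_live by auto
    show "card (\<rho> ` R) = card R'" using card_image[OF inj] card_R' by simp
  qed (simp add: R'_def)
  have \<rho>'_live: "\<rho>' s \<in> R" and \<rho>_\<rho>': "\<rho> (\<rho>' s) = s" if "s \<in> R'" for s
    unfolding \<rho>'_def using that img by (auto simp: inv_into_into f_inv_into_f)
  have \<rho>'_\<rho>: "\<rho>' (\<rho> r) = r" if "r \<in> R" for r unfolding \<rho>'_def by (rule inv_into_f_f[OF inj that])
  have g_sum: "0 \<le> (\<Sum>i\<in>UNIV. \<Sum>j\<in>UNIV. g i j)" by (intro sum_nonneg g)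
  have p_le_C: "p t \<le> C" if "t \<in> {1..T}" for t
  proof -
    have "\<bar>p t\<bar> \<le> (\<Sum>t = 1..T. \<bar>p t\<bar>)" using that by (intro member_le_sum) auto
    then show ?thesis using g_sum unfolding C_def by linarith
  qed
  have C: "1 + (\<Sum>i\<in>UNIV. \<Sum>j\<in>UNIV. g i j) < C"
  proof -
    have "0 \<le> (\<Sum>t = 1..T. \<bar>p t\<bar>)" by (intro sum_nonneg) simp
    then show ?thesis unfolding C_def by linarith
  qed
  have idle: "idle_outside T g p R" unfolding R_def by (rule idle_outside_undercut_free[OF g])
  have idle': "idle_outside T g p' R'"
  proof -
    have "reserve_price g p' R' d < p' d" if "d \<in> {1..T} - R'" for d
    proof -
      have "R' \<inter> {..<d} = {}" using that by (auto simp: R'_def)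
      then show ?thesis using C that by (simp add: reserve_price_def p'_def)
    qed
    then show ?thesis using g R' by (simp add: idle_outside_def)
  qed
  interpret retiming T g p p' R R' \<rho> \<rho>'
  proof
    show "p' (\<rho> r) = p r" if "r \<in> R" for r using that \<rho>_live \<rho>'_\<rho> by (simp add: p'_def)
  qed (fact idle idle' \<rho>_live \<rho>'_live \<rho>'_\<rho> \<rho>_\<rho>' mono)+
  interpret S: retiming T g p' p R' R \<rho>' \<rho> by (rule swap)

  have "nondecreasing_over_time T p'"
    unfolding nondecreasing_over_time_def
  proof (rule monotone_onI)
    fix s t assume st: "s \<in> {1..T}" "t \<in> {1..T}" "s \<le> t"
    show "p' t \<le> p' s"
    proof (cases "s \<in> R'")
      case True
      then have tR': "t \<in> R'" using st by (auto simp: R'_def)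
      have "\<rho>' s \<le> \<rho>' t" using strict_mono_on_leD[OF S.\<rho>_mono True tR' st(3)] .
      then have "p (\<rho>' t) \<le> p (\<rho>' s)"
        using \<rho>'_live[OF tR'] \<rho>'_live[OF True] by (cases "\<rho>' s = \<rho>' t") (auto simp: R_def undercut_free_def)
      then show ?thesis using True tR' by (simp add: p'_def)
    next
      case False
      have "p (\<rho>' t) \<le> C" if "t \<in> R'" using p_le_C \<rho>'_live[OF that] R by blast
      then show ?thesis using False by (simp add: p'_def)
    qed
  qed
  moreover have "same_equilibrium_paths T g F p p'"
    unfolding same_equilibrium_paths_def
  proof (intro exI[of _ R] exI[of _ \<rho>] conjI allI impI ballI)
    fix \<sigma> assume eq: "equilibrium T g F p \<sigma>"
    \<comment> \<open>With nobody buying, the prior may be kept forever: Bayes' rule only ever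
      conditions on the whole space.\<close>
    let ?never = "\<lambda>_ _ _ _. False" and ?prior = "\<lambda>i _. PiM (UNIV - {i}) (\<lambda>_. F)"
    have adm: "admissible F i (PiM (UNIV - {i}) (\<lambda>_. F))" for i :: 'b
    proof -
      interpret P: product_prob_space "\<lambda>_. F" "UNIV - {i}" by unfold_locales
      have "AE y in F. y \<in> {0..1}" using F(2) by (intro F.AE_prob_1) simp
      then have "AE w in PiM (UNIV - {i}) (\<lambda>_. F). \<forall>j \<in> UNIV - {i}. w j \<in> {0..1}"
        by (intro AE_finite_allI AE_PiM_component F.prob_space_axioms) auto
      then show ?thesis by (simp add: admissible_def P.prob_space_axioms)
    qed
    have never: "measurable_profile ?never" by (simp add: measurable_profile_def)
    have "rational_at g F p' ?never ?prior i t' H'"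
      if t': "t' \<le> T" "H' \<in> histories T t'" "\<not> clean T R' H'" for i t' H'
    proof -
      \<comment> \<open>A purchase outside \<open>R'\<close> has taken place in the tail, so only
        prohibitive rounds remain.\<close>
      obtain k where k: "k < length H'" "T - k \<notin> R'" using t'(3) by (auto simp: clean_def)
      have "t' < T - k" using k histories_length[OF t'(2)] by simp
      then have idle_now: "t' \<notin> R'" using k(2) by (auto simp: R'_def)
      have no_later: "s \<notin> R'" if "s \<le> t'" for s using that idle_now t'(1) by (auto simp: R'_def)
      \<comment> \<open>Postponing leaves the plan no round at which to buy, so no plan earns more
        than 0.\<close>
      have eval: "continuation g p' ?never \<delta> i x t' w H' \<le> 0" if "i \<notin> bought H'" "x \<le> 1" for \<delta> x w
      proof -
        have "continuation g p' ?never \<delta> i x t' w H' \<le>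
          continuation g p' ?never (postpone T R' (length H') \<delta>) i x t' w H'"
          using t' histories_length[OF t'(2)] that
          by (intro continuation_le_postpone[OF idle']) auto
        also have "\<dots> = continuation g p' ?never (\<lambda>_ _ _. False) i x t' w H'"
          by (rule continuation_cong) (use no_later in \<open>auto simp: postpone_def\<close>)
        also have "\<dots> = 0" by (induction t' arbitrary: H') auto
        finally show ?thesis .
      qed
      have zero: "continuation g p' ?never (?never i) i x t' w H' = 0" for x w
        by (induction t' arbitrary: H') auto
      show ?thesis
        unfolding rational_at_def
      proof (intro conjI impI allI ballI, goal_cases)
        case 1
        show ?case by (rule adm)
      next
        case (2 h)
        have P: "purchasers ?never t' w H' = {}" for w by (simp add: purchasers_def)
        have "h = {}" using 2(3) by (rule contrapos_pp) (simp add: P)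
        then have "{w \<in> space (?prior i H'). purchasers ?never t' w H' - {i} = h} = space (?prior i H')"
          by (simp add: P)
        then show ?case
          using adm[of i] by (simp add: uniform_measure_full admissible_def)
      next
        case (3 x \<delta>)
        then show ?case
          by (intro expected_payoff_mono[OF borel never adm]) (simp_all only: zero eval atLeastAtMost_iff not_False_eq_True)
      next
        case (4 x)
        then show ?case
          using idle_waiting_value_gt[OF borel never adm[of i] idle', of t' H' x] idle_now t'(1) by auto
      qed
    qed
    then obtain \<sigma>' where "equilibrium T g F p' \<sigma>'"
      "\<And>v. (\<And>i. v i \<in> {0..1}) \<Longrightarrow> aligned T R R' \<rho> 0 (play \<sigma> T v []) 0 (play \<sigma>' T v [])"
      using transfer_equilibrium[OF borel eq never] by blast
    then show "\<exists>\<sigma>'. equilibrium T g F p' \<sigma>' \<and> same_path_retimed T R \<rho> \<sigma> \<sigma>'"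
      using same_path_retimed_of_aligned[OF _ R img] by blast
  next
    fix \<sigma>' assume eq: "equilibrium T g F p' \<sigma>'"
    obtain \<mu>0 where "measurable_profile \<sigma>0"
      and rat0: "\<And>i t H. t \<le> T \<Longrightarrow> H \<in> histories T t \<Longrightarrow> rational_at g F p \<sigma>0 \<mu>0 i t H"
      using eq0 unfolding equilibrium_iff by blast
    then obtain \<sigma> where \<sigma>: "equilibrium T g F p \<sigma>"
      "\<And>v. (\<And>i. v i \<in> {0..1}) \<Longrightarrow> aligned T R' R \<rho>' 0 (play \<sigma>' T v []) 0 (play \<sigma> T v [])"
      using S.transfer_equilibrium[OF borel eq] by blast
    have "same_path_retimed T R \<rho> \<sigma> \<sigma>'"
      by (rule same_path_retimed_of_aligned[OF S.aligned_swap[OF \<sigma>(2)] R img])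
    then show "\<exists>\<sigma>. equilibrium T g F p \<sigma> \<and> same_path_retimed T R \<rho> \<sigma> \<sigma>'" using \<sigma>(1) by blast
  qed (use R R' img mono price in auto)
  ultimately show ?thesis by blast
qed

section \<open>Threshold decisions\<close>

lemma equilibrium_threshold_decision:
  assumes borel: "sets F = sets borel" and eq: "equilibrium T g F p \<sigma>"
  shows "threshold_decision T \<sigma> i"
proof -
  obtain \<mu> where meas: "measurable_profile \<sigma>"
    and rat: "\<And>i t H. t \<le> T \<Longrightarrow> H \<in> histories T t \<Longrightarrow> rational_at g F p \<sigma> \<mu> i t H"
    using eq unfolding equilibrium_iff by blast
  have "\<exists>\<tau>. \<forall>x \<in> {0..1}. \<sigma> i t x H \<longleftrightarrow> x \<ge> \<tau>"
    if tH: "t \<in> {1..T}" "H \<in> histories T t" "i \<notin> bought H" for t H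
  proof -
    have r: "rational_at g F p \<sigma> \<mu> i t H" using rat that by simp
    then have "admissible F i (\<mu> i H)" by (simp add: rational_at_def)
    then obtain \<tau> where "\<forall>x \<in> {0..1}. utility g p i x t H \<ge> waiting_value g p \<sigma> (\<mu> i H) i x t H \<longleftrightarrow> x \<ge> \<tau>"
      using purchase_threshold[OF borel meas _ tH(3)] by blast
    then show ?thesis using r tH unfolding rational_at_def by (intro exI[of _ \<tau>]) auto
  qed
  \<comment> \<open>The length of a history encodes the round, so one threshold per history can be
    chosen.\<close>
  then have "\<forall>H. \<exists>\<tau>. length H < T \<and> H \<in> histories T (T - length H) \<and> i \<notin> bought H \<longrightarrow>
      (\<forall>x \<in> {0..1}. \<sigma> i (T - length H) x H \<longleftrightarrow> x \<ge> \<tau>)"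
    by (metis One_nat_def Suc_leI atLeastAtMost_iff diff_le_self zero_less_diff)
  then obtain \<tau> where \<tau>: "\<And>H x. length H < T \<Longrightarrow> H \<in> histories T (T - length H) \<Longrightarrow> i \<notin> bought H \<Longrightarrow>
      x \<in> {0..1} \<Longrightarrow> \<sigma> i (T - length H) x H \<longleftrightarrow> x \<ge> \<tau> H"
    by metis
  \<comment> \<open>A buyer who is still present has a valuation below all her past thresholds, so taking the
      running minimum makes the thresholds monotone without affecting her decision.\<close>
  define \<theta> where "\<theta> t H = Min ((\<lambda>k. \<tau> (take k H)) ` {..length H})" for t :: nat and H
  have "\<theta> (t - 1) (H @ [h]) \<le> \<theta> t H" for t H h
    unfolding \<theta>_def
  proof (rule Min_antimono)
    show "(\<lambda>k. \<tau> (take k H)) ` {..length H} \<subseteq> (\<lambda>k. \<tau> (take k (H @ [h]))) ` {..length (H @ [h])}"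
      by (rule image_subsetI, rename_tac k, rule_tac x = k in image_eqI) auto
  qed auto
  moreover have "\<sigma> i t x H \<longleftrightarrow> x \<ge> \<theta> t H"
    if t: "t \<in> {1..T}" and H: "H \<in> histories T t" and x: "x \<in> {0..1}"
      and np: "not_yet_purchased T \<sigma> i x H" for t H x
  proof -
    have len: "length H = T - t" by (rule histories_length[OF H])
    have nb: "i \<notin> bought (take k H)" for k
      using np set_take_subset[of k H] by (auto simp: not_yet_purchased_def bought_def)
    have hist: "take k H \<in> histories T (T - k)" if "k \<le> length H" for k
      using H that len by (auto simp: histories_def)
    have "x < \<tau> (take k H)" if "k < length H" for k
    proof -
      have "\<not> \<sigma> i (T - k) x (take k H)" using np that by (simp add: not_yet_purchased_def)
      moreover have "k < T" using that len by simp
      ultimately show ?thesis using \<tau>[of "take k H" x] hist[of k] nb[of k] that x len by simp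
    qed
    moreover have "\<sigma> i t x H \<longleftrightarrow> x \<ge> \<tau> H"
      using \<tau>[of H x] hist[of "length H"] nb[of "length H"] x t len by simp
    moreover have "x \<ge> \<theta> t H \<longleftrightarrow> (\<exists>k \<le> length H. x \<ge> \<tau> (take k H))"
      unfolding \<theta>_def by (subst Min_le_iff) auto
    ultimately show ?thesis by (metis le_eq_less_or_eq linorder_not_less take_all_iff order_refl)
  qed
  ultimately show ?thesis unfolding threshold_decision_def by blast
qed

theorem proposition1:
  fixes T :: nat
    and g :: "'b::finite \<Rightarrow> 'b \<Rightarrow> real"
    and F :: "real measure"
  assumes g_nonneg: "\<And>i j. g i j \<ge> 0"
    and F_distribution: "real_distribution F"
    and F_unit: "measure F {0..1} = 1"
    and F_continuous: "continuous_on UNIV (cdf F)"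
  shows "(\<forall>b p. equilibrium_selection T g F b \<and> optimal_prices T g F b p \<longrightarrow>
            (\<exists>p'. nondecreasing_over_time T p' \<and> same_equilibrium_paths T g F p p'))
       \<and> (\<forall>p \<sigma>. nondecreasing_over_time T p \<and> equilibrium T g F p \<sigma> \<longrightarrow>
            (\<forall>i. threshold_decision T \<sigma> i))"
  using same_equilibrium_paths_nondecreasing[OF g_nonneg F_distribution F_unit]
    equilibrium_threshold_decision[OF real_distribution.events_eq_borel[OF F_distribution]]
  by (auto simp: optimal_prices_def)

end
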